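(* For every simple path encoding $(J,L,L_N)$, the graph isomorphism problem on the class of graphs encoded by $(J,L,L_N)$ is isomorphism-complete.
   Context: Let $J$ be a finite set, $L\colon J\times J\to\{A,N\}$, $L_N\colon J\times J\to\mathbb{N}\cup\{\infty\}$. A graph $G$ belongs to the class encoded by $(J,L,L_N)$ if there is a map $\phi\colon V(G)\to J$ such that: (1) whenever $L(\phi(v),j)=A$ and $L_N(\phi(v),j)\neq\infty$, there are at most $L_N(\phi(v),j)$ vertices $v'\neq v$ with $\phi(v')=j$ non-adjacent to $v$; (2) whenever $L(\phi(v),j)=N$ and $L_N(\phi(v),j)\neq\infty$, there are at most $L_N(\phi(v),j)$ vertices $v'\neq v$ with $\phi(v')=j$ adjacent to $v$. The triple $(J,L,L_N)$ is a simple path encoding if $L$ is symmetric ($L(j,j')=L(j',j)$ for all $j,j'$) and there is a sequence $(p_1,\dots,p_t)$, $t\ge 2$, of pairwise distinct elements of $J$ with $L_N(p_1,p_2)=\infty$, $L_N(p_t,p_{t-1})\ge 2$, and $L_N(p_k,p_{k+1})\ge 1$ and $L_N(p_{k+1},p_k)\ge 1$ for all $1\le k<t$. Isomorphism-complete means polynomial-time equivalent to general graph isomorphism. *)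

theory Defs
  imports
    "HOL-Library.Extended_Nat"
    "HOL-Library.FuncSet"
    "HOL-Computational_Algebra.Polynomial"
    "Graph_Theory.Pair_Digraph"
    "Graph_Theory.Digraph_Isomorphism"
begin

section \<open>Graph classes encoded by path encodings\<close>

text \<open>
  A (finite, simple, undirected) graph is a \<^const>\<open>pair_graph\<close>: a finite, loop-free
  digraph with a symmetric set of arcs; adjacency of \<open>u\<close> and \<open>v\<close> is \<open>(u, v) \<in> parcs G\<close>.
\<close>

datatype label = LabA | LabN

definition encoded_by ::
  "'j set \<Rightarrow> ('j \<Rightarrow> 'j \<Rightarrow> label) \<Rightarrow> ('j \<Rightarrow> 'j \<Rightarrow> enat) \<Rightarrow> 'v pair_pre_digraph \<Rightarrow> bool"
where
  "encoded_by J L LN G \<longleftrightarrow>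
     (\<exists>\<phi> \<in> pverts G \<rightarrow> J. \<forall>v \<in> pverts G. \<forall>j \<in> J.
        (L (\<phi> v) j = LabA \<and> LN (\<phi> v) j \<noteq> \<infinity> \<longrightarrow>
           enat (card {v' \<in> pverts G. v' \<noteq> v \<and> \<phi> v' = j \<and> (v, v') \<notin> parcs G}) \<le> LN (\<phi> v) j) \<and>
        (L (\<phi> v) j = LabN \<and> LN (\<phi> v) j \<noteq> \<infinity> \<longrightarrow>
           enat (card {v' \<in> pverts G. v' \<noteq> v \<and> \<phi> v' = j \<and> (v, v') \<in> parcs G}) \<le> LN (\<phi> v) j))"

text \<open>
  The sequence \<open>p\<^sub>1, \<dots>, p\<^sub>t\<close> is the list \<open>p\<close>, so that \<open>p\<^sub>k\<close> is \<open>p ! (k - 1)\<close>.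
\<close>

definition simple_path_encoding ::
  "'j set \<Rightarrow> ('j \<Rightarrow> 'j \<Rightarrow> label) \<Rightarrow> ('j \<Rightarrow> 'j \<Rightarrow> enat) \<Rightarrow> bool"
where
  "simple_path_encoding J L LN \<longleftrightarrow>
     finite J \<and>
     (\<forall>j \<in> J. \<forall>j' \<in> J. L j j' = L j' j) \<and>
     (\<exists>p. length p \<ge> 2 \<and> distinct p \<and> set p \<subseteq> J \<and>
        LN (p ! 0) (p ! 1) = \<infinity> \<and>
        LN (p ! (length p - 1)) (p ! (length p - 2)) \<ge> 2 \<and>
        (\<forall>k. k + 1 < length p \<longrightarrow>
           LN (p ! k) (p ! (k + 1)) \<ge> 1 \<and> LN (p ! (k + 1)) (p ! k) \<ge> 1))"


section \<open>Polynomial-time computable functions on bit strings\<close>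

text \<open>
  The machine model is the random access machine with unit cost, whose only arithmetic
  operations are addition and truncated subtraction. Since a single step lengthens the largest
  number present by at most one bit, \<open>t\<close> steps can be simulated by a Turing machine in time
  polynomial in \<open>t\<close> and the input length, and conversely; hence the functions computable
  in polynomial time are the same as for Turing machines.

  There are finitely many registers in use (those named in the program) and an unbounded
  memory that is addressed indirectly. The input word is in memory cells \<open>0, \<dots>, n - 1\<close>
  and its length \<open>n\<close> is in register 0; everything else is initially 0. Output bits
  are appended one at a time to a write-only output. The machine halts when the program
  counter leaves the program.
\<close>

datatype instr =
    Const nat nat      \<comment> \<open>\<open>R[r] := k\<close>\<close>
  | Add nat nat nat    \<comment> \<open>\<open>R[r] := R[a] + R[b]\<close>\<close>
  | Sub nat nat nat    \<comment> \<open>\<open>R[r] := R[a] - R[b]\<close>, truncated at 0\<close>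
  | Load nat nat       \<comment> \<open>\<open>R[r] := M[R[a]]\<close>\<close>
  | Store nat nat      \<comment> \<open>\<open>M[R[a]] := R[b]\<close>\<close>
  | Write nat          \<comment> \<open>output the bit \<open>R[a] \<noteq> 0\<close>\<close>
  | JumpZ nat nat      \<comment> \<open>if \<open>R[a] = 0\<close> then go to instruction \<open>l\<close>\<close>

record ram_state =
  pc :: nat
  regs :: "nat \<Rightarrow> nat"
  mem :: "nat \<Rightarrow> nat"
  out :: "bool list"

fun exec_instr :: "instr \<Rightarrow> ram_state \<Rightarrow> ram_state" where
  "exec_instr (Const r k) s = s\<lparr>pc := pc s + 1, regs := (regs s)(r := k)\<rparr>"
| "exec_instr (Add r a b) s = s\<lparr>pc := pc s + 1, regs := (regs s)(r := regs s a + regs s b)\<rparr>"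
| "exec_instr (Sub r a b) s = s\<lparr>pc := pc s + 1, regs := (regs s)(r := regs s a - regs s b)\<rparr>"
| "exec_instr (Load r a) s = s\<lparr>pc := pc s + 1, regs := (regs s)(r := mem s (regs s a))\<rparr>"
| "exec_instr (Store a b) s = s\<lparr>pc := pc s + 1, mem := (mem s)(regs s a := regs s b)\<rparr>"
| "exec_instr (Write a) s = s\<lparr>pc := pc s + 1, out := out s @ [regs s a \<noteq> 0]\<rparr>"
| "exec_instr (JumpZ a l) s = s\<lparr>pc := (if regs s a = 0 then l else pc s + 1)\<rparr>"

definition halted :: "instr list \<Rightarrow> ram_state \<Rightarrow> bool" where
  "halted P s \<longleftrightarrow> length P \<le> pc s"

definition ram_step :: "instr list \<Rightarrow> ram_state \<Rightarrow> ram_state" where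
  "ram_step P s = (if halted P s then s else exec_instr (P ! pc s) s)"

definition ram_init :: "bool list \<Rightarrow> ram_state" where
  "ram_init x =
     \<lparr>pc = 0,
      regs = (\<lambda>r. if r = 0 then length x else 0),
      mem = (\<lambda>i. if i < length x \<and> x ! i then 1 else 0),
      out = []\<rparr>"

definition poly_time_computable :: "(bool list \<Rightarrow> bool list) \<Rightarrow> bool" where
  "poly_time_computable f \<longleftrightarrow>
     (\<exists>(P :: instr list) (q :: nat poly). \<forall>x. \<exists>t \<le> poly q (length x).
        halted P ((ram_step P ^^ t) (ram_init x)) \<and>
        out ((ram_step P ^^ t) (ram_init x)) = f x)"


section \<open>Promise problems and the graph isomorphism problem on a class\<close>

text \<open>
  Membership in a class of graphs need not be decidable in polynomial time, so the
  isomorphism problem on a class is a promise problem: only pairs of graphs from the class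
  are instances, and a reduction is unconstrained on words that do not encode an instance.
\<close>

record promise_problem =
  yes_instances :: "bool list set"
  no_instances :: "bool list set"

definition poly_reducible :: "promise_problem \<Rightarrow> promise_problem \<Rightarrow> bool" where
  "poly_reducible Q R \<longleftrightarrow>
     (\<exists>f. poly_time_computable f \<and>
        f ` yes_instances Q \<subseteq> yes_instances R \<and>
        f ` no_instances Q \<subseteq> no_instances R)"

definition poly_equivalent :: "promise_problem \<Rightarrow> promise_problem \<Rightarrow> bool" where
  "poly_equivalent Q R \<longleftrightarrow> poly_reducible Q R \<and> poly_reducible R Q"

text \<open>
  Only graphs with vertex set \<open>{0, \<dots>, n - 1}\<close> are represented as words. Such a graph
  is written as \<open>n\<close> in unary, a separating zero, and its adjacency matrix row by row.
\<close>

definition std_graph :: "nat pair_pre_digraph \<Rightarrow> bool" where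
  "std_graph G \<longleftrightarrow> pair_graph G \<and> pverts G = {..<card (pverts G)}"

definition graph_code :: "nat pair_pre_digraph \<Rightarrow> bool list" where
  "graph_code G =
     (let n = card (pverts G)
      in replicate n True @ [False] @ [(i, j) \<in> parcs G. i \<leftarrow> [0..<n], j \<leftarrow> [0..<n]])"

definition graph_iso_problem :: "(nat pair_pre_digraph \<Rightarrow> bool) \<Rightarrow> promise_problem" where
  "graph_iso_problem C =
     \<lparr>yes_instances = {graph_code G @ graph_code H | G H.
         std_graph G \<and> std_graph H \<and> C G \<and> C H \<and> digraph_iso (with_proj G) (with_proj H)},
      no_instances = {graph_code G @ graph_code H | G H.
         std_graph G \<and> std_graph H \<and> C G \<and> C H \<and> \<not> digraph_iso (with_proj G) (with_proj H)}\<rparr>"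

definition isomorphism_complete :: "(nat pair_pre_digraph \<Rightarrow> bool) \<Rightarrow> bool" where
  "isomorphism_complete C \<longleftrightarrow>
     poly_equivalent (graph_iso_problem C) (graph_iso_problem (\<lambda>_. True))"

end

(*
  The reduction replaces a graph on n vertices by a subdivision. Every vertex u emits paths
  with one vertex in each class p_1, ..., p_t, one path for every number v < n + 3, and the
  paths from u towards v and from v towards u end in the same vertex exactly if u and v are
  adjacent. Isolated vertices are added and the adjacency between two classes is complemented
  where L prescribes A. The exceptions from L that remain are the edges of the subdivision,
  which are few enough for LN.

  An isomorphism of the constructed graphs need not preserve the classes. But class k consists
  of 2^k blocks of (n + 3)^2 vertices, while a vertex has at most n + 3 neighbours in the
  subdivision. So the degree of a vertex determines a sum of powers of 2, hence the classes to
  which it is joined by default, and the isomorphism is one of subdivisions. In these, the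
  original vertices are those of degree at least 3, and two of them are adjacent exactly if
  there is a walk of length 2 (t - 1) between them.

  As 2^t and L are constants, the program that computes the reduction consists of nested loops
  over the blocks and the coordinates u and v; the answer for each pair of vertices is a
  Boolean combination of comparisons and one access to the input matrix.
*)

theory Submission
  imports Defs "HOL-Library.Nat_Bijection"
begin


section \<open>Structured programs for the random access machine\<close>

text \<open>The paths lead from u towards every v < n + 3, not only towards neighbours. So the
  vertex set is a grid that depends on n alone, and every original vertex has the same subdivision
  degree m = n + 3, however few neighbours it has in the input. The constant 3 serves twice: it puts
  m above 2, the largest degree of any other vertex of the subdivision, and it gives 2 m + 1 < m^2,
  so that the disturbance of a degree by the subdivision cannot confuse two multiples of m^2.

  Adjacency is expressed by merging two path ends and not by an edge between them: a merged end has
  two neighbours in class p_(t-1), which is what LN(p_t, p_(t-1)) >= 2 allows, whereas LN(p_t, p_t)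
  may be 0. The m neighbours of an original vertex are what the infinite entry LN(p_1, p_2) is for.

  An isomorphism may exchange classes with equal rows of L. Equality of rows is enough, because L is
  symmetric and the argument applies to both ends of a pair.

  The reduction is a total function although the problem has a promise, so the program has to halt
  in polynomial time on meaningless words too.\<close>

datatype com = Ins instr | Seq com com (infixr ";;" 60) | IfZ nat com com | While nat com

primrec csize :: "com \<Rightarrow> nat" where
  "csize (Ins i) = 1"
| "csize (c ;; d) = csize c + csize d"
| "csize (IfZ r c d) = csize c + csize d + 2"
| "csize (While r c) = csize c + 2"

text \<open>Register 1 is kept at 0, so that \<^term>\<open>JumpZ 1 l\<close> is an unconditional jump.\<close>

primrec compile :: "nat \<Rightarrow> com \<Rightarrow> instr list" where
  "compile a (Ins i) = [i]"
| "compile a (c ;; d) = compile a c @ compile (a + csize c) d"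
| "compile a (IfZ r c d) = JumpZ r (a + csize d + 2) # compile (a + 1) d @
     JumpZ 1 (a + csize c + csize d + 2) # compile (a + csize d + 2) c"
| "compile a (While r c) = JumpZ r (a + csize c + 2) # compile (a + 1) c @ [JumpZ 1 a]"

lemma length_compile [simp]: "length (compile a c) = csize c"
  by (induction c arbitrary: a) auto

section \<open>Running compiled code inside a larger program\<close>

text \<open>The time is an upper bound and not exact, so that branches of different cost can share
  one bound.\<close>

definition reaches :: "instr list \<Rightarrow> nat \<Rightarrow> ram_state \<Rightarrow> ram_state \<Rightarrow> bool" where
  "reaches P T s s' \<longleftrightarrow> (\<exists>t\<le>T. (ram_step P ^^ t) s = s')"

lemma reaches_mono: "reaches P T s s' \<Longrightarrow> T \<le> T' \<Longrightarrow> reaches P T' s s'"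
  unfolding reaches_def using le_trans by blast

lemma reaches_trans:
  assumes "reaches P T s s'" "reaches P T' s' s''"
  shows "reaches P (T + T') s s''"
proof -
  obtain t t' where "t \<le> T" "(ram_step P ^^ t) s = s'" "t' \<le> T'" "(ram_step P ^^ t') s' = s''"
    using assms unfolding reaches_def by blast
  then show ?thesis unfolding reaches_def
    by (intro exI[of _ "t' + t"]) (auto simp: funpow_add)
qed

lemma reaches_step:
  assumes "pc s < length P" "exec_instr (P ! pc s) s = s'"
  shows "reaches P 1 s s'"
  unfolding reaches_def by (rule exI[of _ 1]) (use assms in \<open>auto simp: ram_step_def halted_def\<close>)

lemma reaches_instr:
  assumes "P = a @ i # b" "pc s = length a" "exec_instr i s = s'"
  shows "reaches P 1 s s'"
  by (rule reaches_step) (use assms in auto)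

text \<open>The surrounding code \<open>a\<close>, \<open>b\<close> and the earlier output
  \<open>zs\<close> are arbitrary, so that a fact proved once applies wherever the command ends up.
  The memory is the same on both sides: the programs never store, and the input stays readable
  throughout.\<close>

definition exe :: "(nat \<Rightarrow> nat) \<Rightarrow> com \<Rightarrow> (nat \<Rightarrow> nat) \<Rightarrow> nat \<Rightarrow> (nat \<Rightarrow> nat) \<Rightarrow> bool list \<Rightarrow> bool" where
  "exe \<mu> c \<rho> T \<rho>' ys \<longleftrightarrow> (\<forall>a b zs.
     reaches (a @ compile (length a) c @ b) T
       \<lparr>pc = length a, regs = \<rho>, mem = \<mu>, out = zs\<rparr>
       \<lparr>pc = length a + csize c, regs = \<rho>', mem = \<mu>, out = zs @ ys\<rparr>)"

lemma exe_mono: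
  assumes "exe \<mu> c \<rho> T \<rho>' ys" "T \<le> T'"
  shows "exe \<mu> c \<rho> T' \<rho>' ys"
  using assms reaches_mono unfolding exe_def by blast

lemma exe_Ins:
  assumes "\<And>l zs. exec_instr i \<lparr>pc = l, regs = \<rho>, mem = \<mu>, out = zs\<rparr> =
      \<lparr>pc = l + 1, regs = \<rho>', mem = \<mu>, out = zs @ ys\<rparr>"
  shows "exe \<mu> (Ins i) \<rho> 1 \<rho>' ys"
  unfolding exe_def by (intro allI, rule reaches_instr) (use assms in simp_all)

lemma exe_Const: "exe \<mu> (Ins (Const r k)) \<rho> 1 (\<rho>(r := k)) []"
  by (rule exe_Ins) simp

lemma exe_Add: "exe \<mu> (Ins (Add r a b)) \<rho> 1 (\<rho>(r := \<rho> a + \<rho> b)) []"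
  by (rule exe_Ins) simp

lemma exe_Sub: "exe \<mu> (Ins (Sub r a b)) \<rho> 1 (\<rho>(r := \<rho> a - \<rho> b)) []"
  by (rule exe_Ins) simp

lemma exe_Load: "exe \<mu> (Ins (Load r a)) \<rho> 1 (\<rho>(r := \<mu> (\<rho> a))) []"
  by (rule exe_Ins) simp

lemma exe_Write: "exe \<mu> (Ins (Write a)) \<rho> 1 \<rho> [\<rho> a \<noteq> 0]"
  by (rule exe_Ins) simp

lemma exe_Seq:
  assumes "exe \<mu> c \<rho> T \<rho>' ys" "exe \<mu> d \<rho>' T' \<rho>'' zs"
  shows "exe \<mu> (c ;; d) \<rho> (T + T') \<rho>'' (ys @ zs)"
  unfolding exe_def
proof (intro allI)
  fix a b xs
  let ?P = "a @ compile (length a) (c ;; d) @ b"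
  have "reaches ?P T \<lparr>pc = length a, regs = \<rho>, mem = \<mu>, out = xs\<rparr>
      \<lparr>pc = length a + csize c, regs = \<rho>', mem = \<mu>, out = xs @ ys\<rparr>"
    using assms(1)[unfolded exe_def, rule_format, of a "compile (length a + csize c) d @ b" xs] by simp
  moreover have "reaches ?P T' \<lparr>pc = length a + csize c, regs = \<rho>', mem = \<mu>, out = xs @ ys\<rparr>
      \<lparr>pc = length a + csize (c ;; d), regs = \<rho>'', mem = \<mu>, out = xs @ ys @ zs\<rparr>"
    using assms(2)[unfolded exe_def, rule_format, of "a @ compile (length a) c" b "xs @ ys"]
    by (simp add: add.assoc)
  ultimately show "reaches ?P (T + T') \<lparr>pc = length a, regs = \<rho>, mem = \<mu>, out = xs\<rparr>
      \<lparr>pc = length a + csize (c ;; d), regs = \<rho>'', mem = \<mu>, out = xs @ ys @ zs\<rparr>"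
    by (rule reaches_trans)
qed

lemma exe_IfZ_zero:
  assumes "exe \<mu> c \<rho> T \<rho>' ys" "\<rho> r = 0"
  shows "exe \<mu> (IfZ r c d) \<rho> (T + 2) \<rho>' ys"
  unfolding exe_def
proof (intro allI)
  fix a b xs
  let ?P = "a @ compile (length a) (IfZ r c d) @ b"
  have "reaches ?P 1 \<lparr>pc = length a, regs = \<rho>, mem = \<mu>, out = xs\<rparr>
      \<lparr>pc = length a + csize d + 2, regs = \<rho>, mem = \<mu>, out = xs\<rparr>"
    by (rule reaches_instr) (auto simp: assms)
  moreover have "reaches ?P T \<lparr>pc = length a + csize d + 2, regs = \<rho>, mem = \<mu>, out = xs\<rparr>
      \<lparr>pc = length a + csize (IfZ r c d), regs = \<rho>', mem = \<mu>, out = xs @ ys\<rparr>"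
    using assms(1)[unfolded exe_def, rule_format,
        of "a @ JumpZ r (length a + csize d + 2) # compile (length a + 1) d @
          [JumpZ 1 (length a + csize c + csize d + 2)]" b xs]
    by (simp add: algebra_simps)
  ultimately have "reaches ?P (1 + T) \<lparr>pc = length a, regs = \<rho>, mem = \<mu>, out = xs\<rparr>
      \<lparr>pc = length a + csize (IfZ r c d), regs = \<rho>', mem = \<mu>, out = xs @ ys\<rparr>"
    by (rule reaches_trans)
  then show "reaches ?P (T + 2) \<lparr>pc = length a, regs = \<rho>, mem = \<mu>, out = xs\<rparr>
      \<lparr>pc = length a + csize (IfZ r c d), regs = \<rho>', mem = \<mu>, out = xs @ ys\<rparr>"
    by (rule reaches_mono) simp
qed

text \<open>The nonzero branch is laid out first and has to jump over the other one. Its exit is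
  \<open>JumpZ 1\<close>, hence the demand that register 1 is still 0 afterwards.\<close>

lemma exe_IfZ_nonzero:
  assumes "exe \<mu> d \<rho> T \<rho>' ys" "\<rho> r \<noteq> 0" "\<rho>' 1 = 0"
  shows "exe \<mu> (IfZ r c d) \<rho> (T + 2) \<rho>' ys"
  unfolding exe_def
proof (intro allI)
  fix a b xs
  let ?P = "a @ compile (length a) (IfZ r c d) @ b"
  have "reaches ?P 1 \<lparr>pc = length a, regs = \<rho>, mem = \<mu>, out = xs\<rparr>
      \<lparr>pc = length a + 1, regs = \<rho>, mem = \<mu>, out = xs\<rparr>"
    by (rule reaches_instr) (auto simp: assms)
  moreover have "reaches ?P T \<lparr>pc = length a + 1, regs = \<rho>, mem = \<mu>, out = xs\<rparr>
      \<lparr>pc = length a + csize d + 1, regs = \<rho>', mem = \<mu>, out = xs @ ys\<rparr>"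
    using assms(1)[unfolded exe_def, rule_format,
        of "a @ [JumpZ r (length a + csize d + 2)]"
          "JumpZ 1 (length a + csize c + csize d + 2) # compile (length a + csize d + 2) c @ b" xs]
    by (simp add: algebra_simps)
  moreover have "reaches ?P 1 \<lparr>pc = length a + csize d + 1, regs = \<rho>', mem = \<mu>, out = xs @ ys\<rparr>
      \<lparr>pc = length a + csize (IfZ r c d), regs = \<rho>', mem = \<mu>, out = xs @ ys\<rparr>"
    by (rule reaches_instr[where a = "a @ JumpZ r (length a + csize d + 2) # compile (length a + 1) d"])
       (use assms in auto)
  ultimately have "reaches ?P (1 + T + 1) \<lparr>pc = length a, regs = \<rho>, mem = \<mu>, out = xs\<rparr>
      \<lparr>pc = length a + csize (IfZ r c d), regs = \<rho>', mem = \<mu>, out = xs @ ys\<rparr>"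
    by (blast intro: reaches_trans)
  then show "reaches ?P (T + 2) \<lparr>pc = length a, regs = \<rho>, mem = \<mu>, out = xs\<rparr>
      \<lparr>pc = length a + csize (IfZ r c d), regs = \<rho>', mem = \<mu>, out = xs @ ys\<rparr>"
    by simp
qed

lemma exe_While_zero:
  assumes "\<rho> r = 0"
  shows "exe \<mu> (While r c) \<rho> 1 \<rho> []"
  unfolding exe_def by (intro allI reaches_instr) (auto simp: assms)

lemma exe_While_nonzero:
  assumes "exe \<mu> c \<rho> T \<rho>' ys" "\<rho> r \<noteq> 0" "\<rho>' 1 = 0" "exe \<mu> (While r c) \<rho>' T' \<rho>'' zs"
  shows "exe \<mu> (While r c) \<rho> (T + T' + 2) \<rho>'' (ys @ zs)"
  unfolding exe_def
proof (intro allI)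
  fix a b xs
  let ?P = "a @ compile (length a) (While r c) @ b"
  have "reaches ?P 1 \<lparr>pc = length a, regs = \<rho>, mem = \<mu>, out = xs\<rparr>
      \<lparr>pc = length a + 1, regs = \<rho>, mem = \<mu>, out = xs\<rparr>"
    by (rule reaches_instr) (auto simp: assms)
  moreover have "reaches ?P T \<lparr>pc = length a + 1, regs = \<rho>, mem = \<mu>, out = xs\<rparr>
      \<lparr>pc = length a + csize c + 1, regs = \<rho>', mem = \<mu>, out = xs @ ys\<rparr>"
    using assms(1)[unfolded exe_def, rule_format,
        of "a @ [JumpZ r (length a + csize c + 2)]" "JumpZ 1 (length a) # b" xs]
    by (simp add: algebra_simps)
  moreover have "reaches ?P 1 \<lparr>pc = length a + csize c + 1, regs = \<rho>', mem = \<mu>, out = xs @ ys\<rparr>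
      \<lparr>pc = length a, regs = \<rho>', mem = \<mu>, out = xs @ ys\<rparr>"
    by (rule reaches_instr[where a = "a @ JumpZ r (length a + csize c + 2) # compile (length a + 1) c"])
       (use assms in auto)
  moreover have "reaches ?P T' \<lparr>pc = length a, regs = \<rho>', mem = \<mu>, out = xs @ ys\<rparr>
      \<lparr>pc = length a + csize (While r c), regs = \<rho>'', mem = \<mu>, out = xs @ ys @ zs\<rparr>"
    using assms(4)[unfolded exe_def, rule_format, of a b "xs @ ys"] by simp
  ultimately have "reaches ?P (1 + T + 1 + T') \<lparr>pc = length a, regs = \<rho>, mem = \<mu>, out = xs\<rparr>
      \<lparr>pc = length a + csize (While r c), regs = \<rho>'', mem = \<mu>, out = xs @ ys @ zs\<rparr>"
    by (blast intro: reaches_trans)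
  then show "reaches ?P (T + T' + 2) \<lparr>pc = length a, regs = \<rho>, mem = \<mu>, out = xs\<rparr>
      \<lparr>pc = length a + csize (While r c), regs = \<rho>'', mem = \<mu>, out = xs @ ys @ zs\<rparr>"
    by (simp add: algebra_simps)
qed

section \<open>Polynomial time bounds\<close>

definition poly_bounded :: "(nat \<Rightarrow> nat) \<Rightarrow> bool" where
  "poly_bounded T \<longleftrightarrow> (\<exists>q. \<forall>n. T n \<le> poly q n)"

lemma poly_bounded_const: "poly_bounded (\<lambda>_. k)"
  unfolding poly_bounded_def by (rule exI[of _ "[:k:]"]) auto

lemma poly_bounded_id: "poly_bounded (\<lambda>n. n)"
  unfolding poly_bounded_def by (rule exI[of _ "[:0, 1:]"]) auto

lemma poly_bounded_add:
  assumes "poly_bounded S" "poly_bounded T"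
  shows "poly_bounded (\<lambda>n. S n + T n)"
proof -
  obtain p q where "\<And>n. S n \<le> poly p n" "\<And>n. T n \<le> poly q n"
    using assms unfolding poly_bounded_def by blast
  then show ?thesis unfolding poly_bounded_def
    by (intro exI[of _ "p + q"]) (auto intro: add_mono)
qed

lemma poly_bounded_mult:
  assumes "poly_bounded S" "poly_bounded T"
  shows "poly_bounded (\<lambda>n. S n * T n)"
proof -
  obtain p q where "\<And>n. S n \<le> poly p n" "\<And>n. T n \<le> poly q n"
    using assms unfolding poly_bounded_def by blast
  then show ?thesis unfolding poly_bounded_def
    by (intro exI[of _ "p * q"]) (auto intro: mult_mono)
qed

lemmas poly_bounded_intros =
  poly_bounded_const poly_bounded_id poly_bounded_add poly_bounded_mult

text \<open>The code starts at address 0 and nothing follows it, so running off its end is exactly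
  the halting condition of the machine.\<close>

lemma poly_time_computableI:
  assumes "poly_bounded T"
    and "\<And>x. \<exists>\<rho>'. exe (mem (ram_init x)) c (regs (ram_init x)) (T (length x)) \<rho>' (f x)"
  shows "poly_time_computable f"
proof -
  obtain q where q: "T n \<le> poly q n" for n
    using assms(1) unfolding poly_bounded_def by blast
  have "\<exists>t\<le>poly q (length x). halted (compile 0 c) ((ram_step (compile 0 c) ^^ t) (ram_init x)) \<and>
       out ((ram_step (compile 0 c) ^^ t) (ram_init x)) = f x" for x
  proof -
    obtain \<rho>' where "exe (mem (ram_init x)) c (regs (ram_init x)) (T (length x)) \<rho>' (f x)"
      using assms(2) by blast
    from this[unfolded exe_def, rule_format, of "[]" "[]" "[]"]
    obtain t where "t \<le> T (length x)" and
      t: "(ram_step (compile 0 c) ^^ t) (ram_init x) =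
         \<lparr>pc = csize c, regs = \<rho>', mem = mem (ram_init x), out = f x\<rparr>"
      by (auto simp: reaches_def ram_init_def)
    moreover have "t \<le> poly q (length x)" using \<open>t \<le> T (length x)\<close> q le_trans by blast
    ultimately show ?thesis by (auto simp: halted_def)
  qed
  then show ?thesis unfolding poly_time_computable_def by blast
qed


section \<open>Programs described by their output and the registers they may change\<close>

text \<open>Of the final registers only a frame condition is kept. This is what makes nested loops
  manageable: an outer loop needs to know merely that its own registers survive.\<close>

definition emits ::
  "(nat \<Rightarrow> nat) \<Rightarrow> com \<Rightarrow> nat set \<Rightarrow> nat \<Rightarrow> (nat \<Rightarrow> nat) \<Rightarrow> bool list \<Rightarrow> bool" where
  "emits \<mu> c W T \<rho> ys \<longleftrightarrow> (\<exists>\<rho>'. exe \<mu> c \<rho> T \<rho>' ys \<and> (\<forall>r. r \<notin> W \<longrightarrow> \<rho>' r = \<rho> r))"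

lemma emits_mono:
  assumes "emits \<mu> c W T \<rho> ys" "W \<subseteq> W'" "T \<le> T'"
  shows "emits \<mu> c W' T' \<rho> ys"
  using assms exe_mono unfolding emits_def by blast

lemma emits_Write: "emits \<mu> (Ins (Write a)) W 1 \<rho> [\<rho> a \<noteq> 0]"
  unfolding emits_def using exe_Write by blast

lemma emits_exe:
  assumes "exe \<mu> c \<rho> T \<rho>' ys" "\<And>r. r \<notin> W \<Longrightarrow> \<rho>' r = \<rho> r"
  shows "emits \<mu> c W T \<rho> ys"
  using assms unfolding emits_def by blast

lemma emits_Seq:
  assumes "emits \<mu> c W T \<rho> ys"
    and "\<And>\<rho>'. (\<And>r. r \<notin> W \<Longrightarrow> \<rho>' r = \<rho> r) \<Longrightarrow> emits \<mu> d W T' \<rho>' zs"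
  shows "emits \<mu> (c ;; d) W (T + T') \<rho> (ys @ zs)"
proof -
  obtain \<rho>1 where 1: "exe \<mu> c \<rho> T \<rho>1 ys" "\<forall>r. r \<notin> W \<longrightarrow> \<rho>1 r = \<rho> r"
    using assms(1) unfolding emits_def by blast
  then obtain \<rho>2 where "exe \<mu> d \<rho>1 T' \<rho>2 zs" "\<forall>r. r \<notin> W \<longrightarrow> \<rho>2 r = \<rho>1 r"
    using assms(2)[of \<rho>1] unfolding emits_def by blast
  with 1 show ?thesis unfolding emits_def using exe_Seq by metis
qed

lemma emits_exe_Seq:
  assumes "exe \<mu> c \<rho> T \<rho>1 []" "\<And>r. r \<notin> W \<Longrightarrow> \<rho>1 r = \<rho> r" "emits \<mu> d W T' \<rho>1 ys"
  shows "emits \<mu> (c ;; d) W (T + T') \<rho> ys"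
proof -
  obtain \<rho>2 where "exe \<mu> d \<rho>1 T' \<rho>2 ys" "\<forall>r. r \<notin> W \<longrightarrow> \<rho>2 r = \<rho>1 r"
    using assms(3) unfolding emits_def by blast
  then show ?thesis unfolding emits_def
    using exe_Seq[OF assms(1), of d T' \<rho>2 ys] assms(2) by (metis append_Nil)
qed

lemma emits_IfZ:
  assumes "emits \<mu> (if \<rho> r = 0 then c else d) W T \<rho> ys" "\<rho> 1 = 0" "1 \<notin> W"
  shows "emits \<mu> (IfZ r c d) W (T + 2) \<rho> ys"
proof -
  obtain \<rho>' where \<rho>': "exe \<mu> (if \<rho> r = 0 then c else d) \<rho> T \<rho>' ys" "\<forall>r. r \<notin> W \<longrightarrow> \<rho>' r = \<rho> r"
    using assms(1) unfolding emits_def by blast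
  then have "\<rho>' 1 = 0" using assms by simp
  with \<rho>' have "exe \<mu> (IfZ r c d) \<rho> (T + 2) \<rho>' ys"
    using exe_IfZ_zero[of \<mu> c \<rho> T \<rho>' ys r d] exe_IfZ_nonzero[of \<mu> d \<rho> T \<rho>' ys r c]
    by (auto split: if_splits)
  with \<rho>'(2) show ?thesis unfolding emits_def by blast
qed

text \<open>Register 2 is kept at 1. The loop register \<open>d\<close> holds the number of remaining rounds.\<close>

definition For :: "nat \<Rightarrow> nat \<Rightarrow> nat \<Rightarrow> com \<Rightarrow> com" where
  "For i n d c = Ins (Const i 0) ;; Ins (Sub d n i) ;;
     While d (c ;; Ins (Add i i 2) ;; Ins (Sub d n i))"

text \<open>\<open>d\<close> is recomputed from \<open>n\<close> and \<open>i\<close> after every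
  round, so the body may even overwrite it. Only the counter \<open>i\<close> has to survive the
  body, whence the two write sets \<open>W'\<close> and \<open>W\<close>.\<close>

lemma emits_For:
  assumes body: "\<And>\<rho>'. (\<And>r. r \<notin> W \<Longrightarrow> \<rho>' r = \<rho> r) \<Longrightarrow> \<rho>' i < \<rho> n \<Longrightarrow>
      emits \<mu> c W' T \<rho>' (ys (\<rho>' i))"
    and W: "W' \<subseteq> W" "i \<in> W" "d \<in> W" "i \<notin> W'" "n \<notin> W" "1 \<notin> W" "2 \<notin> W" "i \<noteq> d"
    and \<rho>: "\<rho> 1 = 0" "\<rho> 2 = 1"
  shows "emits \<mu> (For i n d c) W (\<rho> n * (T + 4) + 3) \<rho> (concat (map ys [0..<\<rho> n]))"
proof -
  let ?b = "c ;; Ins (Add i i 2) ;; Ins (Sub d n i)"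
  have loop: "emits \<mu> (While d ?b) W (j * (T + 4) + 1) \<rho>' (concat (map ys [\<rho>' i..<\<rho> n]))"
    if "\<And>r. r \<notin> W \<Longrightarrow> \<rho>' r = \<rho> r" "\<rho>' d = \<rho> n - \<rho>' i" "j = \<rho> n - \<rho>' i" for j \<rho>'
    using that
  proof (induction j arbitrary: \<rho>')
    case 0
    then have "emits \<mu> (While d ?b) W 1 \<rho>' []" by (intro emits_exe[OF exe_While_zero]) auto
    with 0 show ?case by simp
  next
    case (Suc j)
    then have lt: "\<rho>' i < \<rho> n" by simp
    obtain \<rho>1 where \<rho>1: "exe \<mu> c \<rho>' T \<rho>1 (ys (\<rho>' i))" "\<forall>r. r \<notin> W' \<longrightarrow> \<rho>1 r = \<rho>' r"
      using body[OF Suc.prems(1) lt] unfolding emits_def by blast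
    let ?\<rho>2 = "\<rho>1(i := \<rho>1 i + \<rho>1 2)" let ?\<rho>3 = "?\<rho>2(d := ?\<rho>2 n - ?\<rho>2 i)"
    have 3: "exe \<mu> ?b \<rho>' (T + (1 + 1)) ?\<rho>3 (ys (\<rho>' i) @ [] @ [])"
      by (rule exe_Seq[OF \<rho>1(1) exe_Seq[OF exe_Add exe_Sub]])
    have at: "\<rho>1 i = \<rho>' i" "\<rho>1 2 = 1" "\<rho>1 n = \<rho> n" "\<rho>1 1 = 0" "n \<noteq> i" "n \<noteq> d" "i \<noteq> 1" "d \<noteq> 1"
      using \<rho>1(2) Suc.prems(1) W \<rho> by auto
    have "emits \<mu> (While d ?b) W (j * (T + 4) + 1) ?\<rho>3 (concat (map ys [?\<rho>3 i..<\<rho> n]))"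
    proof (rule Suc.IH)
      show "?\<rho>3 r = \<rho> r" if "r \<notin> W" for r
        using that \<rho>1(2) Suc.prems(1) W by auto
    qed (use at W Suc.prems lt in auto)
    then obtain \<rho>4 where \<rho>4: "exe \<mu> (While d ?b) ?\<rho>3 (j * (T + 4) + 1) \<rho>4
        (concat (map ys [?\<rho>3 i..<\<rho> n]))" "\<forall>r. r \<notin> W \<longrightarrow> \<rho>4 r = ?\<rho>3 r"
      unfolding emits_def by blast
    have "exe \<mu> (While d ?b) \<rho>' (T + (1 + 1) + (j * (T + 4) + 1) + 2) \<rho>4
        ((ys (\<rho>' i) @ [] @ []) @ concat (map ys [?\<rho>3 i..<\<rho> n]))"
      by (rule exe_While_nonzero[OF 3 _ _ \<rho>4(1)]) (use at lt Suc.prems in auto)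
    moreover have "(ys (\<rho>' i) @ [] @ []) @ concat (map ys [?\<rho>3 i..<\<rho> n]) =
        concat (map ys [\<rho>' i..<\<rho> n])"
      using at lt W by (simp add: upt_conv_Cons)
    moreover have "T + (1 + 1) + (j * (T + 4) + 1) + 2 = Suc j * (T + 4) + 1" by simp
    moreover have "\<rho>4 r = \<rho>' r" if "r \<notin> W" for r
    proof -
      have "\<rho>4 r = ?\<rho>3 r" "r \<noteq> i" "r \<noteq> d" "r \<notin> W'" using that \<rho>4(2) W by auto
      then show ?thesis using \<rho>1(2) by simp
    qed
    ultimately show ?case unfolding emits_def by metis
  qed
  let ?\<rho>1 = "\<rho>(i := 0)" let ?\<rho>2 = "?\<rho>1(d := ?\<rho>1 n - ?\<rho>1 i)"
  have ni: "n \<noteq> i" using W by auto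
  have "emits \<mu> (For i n d c) W (1 + (1 + (\<rho> n * (T + 4) + 1))) \<rho> (concat (map ys [?\<rho>2 i..<\<rho> n]))"
    unfolding For_def
  proof (rule emits_exe_Seq[OF exe_Const], goal_cases)
    case 2
    show ?case
    proof (rule emits_exe_Seq[OF exe_Sub], goal_cases)
      case 2
      show ?case by (rule loop) (use W ni in auto)
    qed (use W in auto)
  qed (use W in auto)
  then show ?thesis using W by (simp add: numeral_3_eq_3)
qed

text \<open>The blocks are unrolled into the program text: their number is fixed with the encoding,
  so the code for block \<open>q\<close> can use \<open>q\<close> as a constant. The base case is a
  no-op on a scratch register.\<close>

primrec seqs :: "(nat \<Rightarrow> com) \<Rightarrow> nat \<Rightarrow> com" where
  "seqs c 0 = Ins (Const 14 0)"
| "seqs c (Suc k) = seqs c k ;; c k"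

lemma emits_seqs:
  assumes "\<And>q \<rho>'. q < Q \<Longrightarrow> (\<And>r. r \<notin> W \<Longrightarrow> \<rho>' r = \<rho> r) \<Longrightarrow> emits \<mu> (c q) W (T q) \<rho>' (ys q)"
    and "14 \<in> W"
  shows "emits \<mu> (seqs c Q) W (1 + (\<Sum>q<Q. T q)) \<rho> (concat (map ys [0..<Q]))"
  using assms(1)
proof (induction Q)
  case 0
  show ?case using assms(2) by (auto intro!: emits_exe exe_Const[of _ 14 0, simplified])
next
  case (Suc Q)
  have "emits \<mu> (seqs c (Suc Q)) W ((1 + (\<Sum>q<Q. T q)) + T Q) \<rho> (concat (map ys [0..<Q]) @ ys Q)"
    unfolding seqs.simps by (rule emits_Seq[OF Suc.IH]) (use Suc.prems in auto)
  then show ?case by (simp add: add.assoc)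
qed

section \<open>Products and Boolean tests\<close>

text \<open>The machine cannot multiply, so register 3 is added \<open>r\<close> times. Adding
  register 1, which is 0, copies \<open>r\<close> into the countdown register 16.\<close>

definition add_prod :: "nat \<Rightarrow> nat \<Rightarrow> com" where
  "add_prod a r = Ins (Add 16 r 1) ;; While 16 (Ins (Add a a 3) ;; Ins (Sub 16 16 2))"

lemma exe_add_prod:
  assumes "a \<notin> {1, 2, 3, 16}" "\<rho> 1 = 0" "\<rho> 2 = 1"
  shows "exe \<mu> (add_prod a r) \<rho> (4 * \<rho> r + 2) (\<rho>(16 := 0, a := \<rho> a + \<rho> r * \<rho> 3)) []"
proof -
  let ?b = "Ins (Add a a 3) ;; Ins (Sub 16 16 2)"
  have loop: "exe \<mu> (While 16 ?b) \<rho>' (4 * k + 1) (\<rho>'(16 := 0, a := \<rho>' a + k * \<rho>' 3)) []"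
    if "\<rho>' 16 = k" "\<rho>' 1 = 0" "\<rho>' 2 = 1" for \<rho>' k
    using that
  proof (induction k arbitrary: \<rho>')
    case 0
    then have eq: "\<rho>'(16 := 0, a := \<rho>' a + 0 * \<rho>' 3) = \<rho>'" by auto
    show ?case unfolding eq using 0 by (auto intro!: exe_While_zero[simplified])
  next
    case (Suc k)
    let ?\<rho>1 = "\<rho>'(a := \<rho>' a + \<rho>' 3)" let ?\<rho>2 = "?\<rho>1(16 := ?\<rho>1 16 - ?\<rho>1 2)"
    have 1: "exe \<mu> ?b \<rho>' (1 + 1) ?\<rho>2 ([] @ [])"
      by (rule exe_Seq[OF exe_Add exe_Sub])
    have 2: "exe \<mu> (While 16 ?b) ?\<rho>2 (4 * k + 1) (?\<rho>2(16 := 0, a := ?\<rho>2 a + k * ?\<rho>2 3)) []"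
      by (rule Suc.IH) (use Suc.prems assms(1) in auto)
    have "exe \<mu> (While 16 ?b) \<rho>' ((1 + 1) + (4 * k + 1) + 2)
        (?\<rho>2(16 := 0, a := ?\<rho>2 a + k * ?\<rho>2 3)) (([] @ []) @ [])"
      by (rule exe_While_nonzero[OF 1 _ _ 2]) (use Suc.prems assms(1) in auto)
    moreover have "?\<rho>2(16 := 0, a := ?\<rho>2 a + k * ?\<rho>2 3) = \<rho>'(16 := 0, a := \<rho>' a + Suc k * \<rho>' 3)"
      using assms(1) by (auto simp: fun_eq_iff)
    moreover have "(1 + 1) + (4 * k + 1) + 2 = 4 * Suc k + 1" by simp
    ultimately show ?case by (simp only: append_Nil)
  qed
  let ?\<rho>1 = "\<rho>(16 := \<rho> r + \<rho> 1)"
  have "exe \<mu> (add_prod a r) \<rho> (1 + (4 * \<rho> r + 1)) (?\<rho>1(16 := 0, a := ?\<rho>1 a + \<rho> r * ?\<rho>1 3)) ([] @ [])"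
    unfolding add_prod_def by (intro exe_Seq[OF exe_Add] loop) (use assms in auto)
  moreover have "?\<rho>1(16 := 0, a := ?\<rho>1 a + \<rho> r * ?\<rho>1 3) = \<rho>(16 := 0, a := \<rho> a + \<rho> r * \<rho> 3)"
    using assms(1) by (auto simp: fun_eq_iff)
  ultimately show ?thesis by simp
qed

text \<open>
  Register 3 holds the number \<open>n\<close> of vertices of the graph being read, register 4 the address of
  its adjacency matrix and register 5 the number \<open>n + 3\<close>. Registers 6 to 9 are the coordinates of
  a pair of vertices of the constructed graph, and 14 to 16 are scratch.
\<close>

datatype bexp =
    BConst bool
  | BEq nat nat
  | BLess nat nat
  | BBit nat nat
  | BNot bexp
  | BAnd bexp bexp

primrec beval :: "(nat \<Rightarrow> nat) \<Rightarrow> (nat \<Rightarrow> nat) \<Rightarrow> bexp \<Rightarrow> bool" where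
  "beval \<mu> \<rho> (BConst p) = p"
| "beval \<mu> \<rho> (BEq r s) = (\<rho> r = \<rho> s)"
| "beval \<mu> \<rho> (BLess r s) = (\<rho> r < \<rho> s)"
| "beval \<mu> \<rho> (BBit r s) = (\<mu> (\<rho> 4 + \<rho> s + \<rho> r * \<rho> 3) \<noteq> 0)"
| "beval \<mu> \<rho> (BNot b) = (\<not> beval \<mu> \<rho> b)"
| "beval \<mu> \<rho> (BAnd b b') = (beval \<mu> \<rho> b \<and> beval \<mu> \<rho> b')"

text \<open>Registers from 14 on are scratch for the tests and may not be read. The row of a
  \<open>BBit\<close> has to be a coordinate register, because a bound on the coordinates then
  limits the time of the multiplication.\<close>

primrec bwf :: "bexp \<Rightarrow> bool" where
  "bwf (BConst p) = True"
| "bwf (BEq r s) = (r < 14 \<and> s < 14)"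
| "bwf (BLess r s) = (r < 14 \<and> s < 14)"
| "bwf (BBit r s) = (r \<in> {6..<10} \<and> s < 14)"
| "bwf (BNot b) = bwf b"
| "bwf (BAnd b b') = (bwf b \<and> bwf b')"

primrec btime :: "bexp \<Rightarrow> nat \<Rightarrow> nat" where
  "btime (BConst p) M = 0"
| "btime (BEq r s) M = 5"
| "btime (BLess r s) M = 3"
| "btime (BBit r s) M = 4 * M + 6"
| "btime (BNot b) M = btime b M"
| "btime (BAnd b b') M = btime b M + btime b' M"

text \<open>Both continuations are passed down, so that no truth value is ever stored. A conjunction
  duplicates \<open>d\<close>, which enlarges the program but not its running time.\<close>

primrec test :: "bexp \<Rightarrow> com \<Rightarrow> com \<Rightarrow> com" where
  "test (BConst p) = (\<lambda>c d. if p then c else d)"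
| "test (BEq r s) = (\<lambda>c d. Ins (Sub 14 r s) ;; Ins (Sub 15 s r) ;; Ins (Add 14 14 15) ;; IfZ 14 c d)"
| "test (BLess r s) = (\<lambda>c d. Ins (Sub 14 s r) ;; IfZ 14 d c)"
| "test (BBit r s) = (\<lambda>c d. Ins (Add 14 4 s) ;; add_prod 14 r ;; Ins (Load 14 14) ;; IfZ 14 d c)"
| "test (BNot b) = (\<lambda>c d. test b d c)"
| "test (BAnd b b') = (\<lambda>c d. test b (test b' c d) d)"

lemma beval_cong:
  assumes "bwf b" "\<And>r. r < 14 \<Longrightarrow> \<rho>' r = \<rho> r"
  shows "beval \<mu> \<rho>' b = beval \<mu> \<rho> b"
  using assms by (induction b) auto

text \<open>The branches are assumed correct for all registers that agree with \<open>\<rho>\<close>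
  outside scratch, since the test has spoilt the scratch by the time it branches. For the same
  reason a conjunction needs \<open>beval_cong\<close>: the first test leaves the value of the
  second one unchanged.\<close>

lemma emits_test:
  assumes "\<And>\<rho>'. (\<And>r. r \<notin> {14, 15, 16} \<Longrightarrow> \<rho>' r = \<rho> r) \<Longrightarrow>
      emits \<mu> (if beval \<mu> \<rho> b then c else d) W T \<rho>' ys"
    and "bwf b" "{14, 15, 16} \<subseteq> W" "1 \<notin> W" "\<rho> 1 = 0" "\<rho> 2 = 1"
    and "\<And>r. r \<in> {6..<10} \<Longrightarrow> \<rho> r \<le> M"
  shows "emits \<mu> (test b c d) W (btime b M + T) \<rho> ys"
  using assms
proof (induction b arbitrary: c d \<rho> T)
  case (BConst p)
  show ?case using BConst.prems(1)[of \<rho>] by auto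
next
  case (BEq r s)
  let ?\<rho>1 = "\<rho>(14 := \<rho> r - \<rho> s)" let ?\<rho>2 = "?\<rho>1(15 := ?\<rho>1 s - ?\<rho>1 r)"
  let ?\<rho>3 = "?\<rho>2(14 := ?\<rho>2 14 + ?\<rho>2 15)"
  have "?\<rho>3 14 = 0 \<longleftrightarrow> \<rho> r = \<rho> s" using BEq.prems(2) by auto
  moreover have "emits \<mu> (if beval \<mu> \<rho> (BEq r s) then c else d) W T ?\<rho>3 ys"
    by (rule BEq.prems(1)) auto
  ultimately have "emits \<mu> (IfZ 14 c d) W (T + 2) ?\<rho>3 ys"
    by (intro emits_IfZ) (use BEq.prems in auto)
  then have "emits \<mu> (Ins (Add 14 14 15) ;; IfZ 14 c d) W (1 + (T + 2)) ?\<rho>2 ys"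
    by (rule emits_exe_Seq[OF exe_Add, rotated]) (use BEq.prems in auto)
  then have "emits \<mu> (Ins (Sub 15 s r) ;; Ins (Add 14 14 15) ;; IfZ 14 c d) W (1 + (1 + (T + 2))) ?\<rho>1 ys"
    by (rule emits_exe_Seq[OF exe_Sub, rotated]) (use BEq.prems in auto)
  then have "emits \<mu> (test (BEq r s) c d) W (1 + (1 + (1 + (T + 2)))) \<rho> ys"
    unfolding test.simps by (rule emits_exe_Seq[OF exe_Sub, rotated]) (use BEq.prems in auto)
  then show ?case by (rule emits_mono) auto
next
  case (BLess r s)
  let ?\<rho>1 = "\<rho>(14 := \<rho> s - \<rho> r)"
  have "emits \<mu> (if beval \<mu> \<rho> (BLess r s) then c else d) W T ?\<rho>1 ys"
    by (rule BLess.prems(1)) auto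
  then have "emits \<mu> (IfZ 14 d c) W (T + 2) ?\<rho>1 ys"
    by (intro emits_IfZ) (use BLess.prems in \<open>auto simp: not_less[symmetric] split: if_splits\<close>)
  then have "emits \<mu> (test (BLess r s) c d) W (1 + (T + 2)) \<rho> ys"
    unfolding test.simps by (rule emits_exe_Seq[OF exe_Sub, rotated]) (use BLess.prems in auto)
  then show ?case by (rule emits_mono) auto
next
  case (BBit r s)
  let ?\<rho>1 = "\<rho>(14 := \<rho> 4 + \<rho> s)" let ?\<rho>2 = "?\<rho>1(16 := 0, 14 := ?\<rho>1 14 + ?\<rho>1 r * ?\<rho>1 3)"
  let ?\<rho>3 = "?\<rho>2(14 := \<mu> (?\<rho>2 14))"
  have r: "r \<noteq> 14" using BBit.prems(2) by auto
  have "emits \<mu> (if beval \<mu> \<rho> (BBit r s) then c else d) W T ?\<rho>3 ys"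
    by (rule BBit.prems(1)) auto
  then have "emits \<mu> (IfZ 14 d c) W (T + 2) ?\<rho>3 ys"
    by (intro emits_IfZ) (use BBit.prems r in \<open>auto split: if_splits\<close>)
  then have "emits \<mu> (Ins (Load 14 14) ;; IfZ 14 d c) W (1 + (T + 2)) ?\<rho>2 ys"
    by (rule emits_exe_Seq[OF exe_Load, rotated]) (use BBit.prems in auto)
  then have "emits \<mu> (add_prod 14 r ;; Ins (Load 14 14) ;; IfZ 14 d c) W
      ((4 * ?\<rho>1 r + 2) + (1 + (T + 2))) ?\<rho>1 ys"
    by (rule emits_exe_Seq[OF exe_add_prod, rotated -1]) (use BBit.prems in auto)
  then have "emits \<mu> (test (BBit r s) c d) W (1 + ((4 * ?\<rho>1 r + 2) + (1 + (T + 2)))) \<rho> ys"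
    unfolding test.simps by (rule emits_exe_Seq[OF exe_Add, rotated]) (use BBit.prems in auto)
  then show ?case
    by (rule emits_mono) (use BBit.prems(2) BBit.prems(7)[of r] r in auto)
next
  case (BNot b)
  have "emits \<mu> (test b d c) W (btime b M + T) \<rho> ys"
  proof (rule BNot.IH)
    fix \<rho>' assume "\<And>r. r \<notin> {14, 15, 16} \<Longrightarrow> \<rho>' r = \<rho> r"
    from BNot.prems(1)[OF this] show "emits \<mu> (if beval \<mu> \<rho> b then d else c) W T \<rho>' ys"
      by (auto split: if_splits)
  qed (use BNot.prems in auto)
  then show ?case by simp
next
  case (BAnd b b')
  have "emits \<mu> (test b (test b' c d) d) W (btime b M + (btime b' M + T)) \<rho> ys"
  proof (rule BAnd.IH(1))
    fix \<rho>' assume \<rho>': "\<And>r. r \<notin> {14, 15, 16} \<Longrightarrow> \<rho>' r = \<rho> r"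
    have eq: "beval \<mu> \<rho>' b' = beval \<mu> \<rho> b'"
      by (rule beval_cong) (use BAnd.prems \<rho>' in auto)
    show "emits \<mu> (if beval \<mu> \<rho> b then test b' c d else d) W (btime b' M + T) \<rho>' ys"
    proof (cases "beval \<mu> \<rho> b")
      case True
      have "emits \<mu> (test b' c d) W (btime b' M + T) \<rho>' ys"
      proof (rule BAnd.IH(2))
        fix \<rho>'' assume "\<And>r. r \<notin> {14, 15, 16} \<Longrightarrow> \<rho>'' r = \<rho>' r"
        with \<rho>' have "\<And>r. r \<notin> {14, 15, 16} \<Longrightarrow> \<rho>'' r = \<rho> r" by metis
        from BAnd.prems(1)[OF this] True show "emits \<mu> (if beval \<mu> \<rho>' b' then c else d) W T \<rho>'' ys"
          by (simp add: eq)
      qed (use BAnd.prems \<rho>' in auto)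
      with True show ?thesis by simp
    next
      case False
      with BAnd.prems(1)[OF \<rho>'] have "emits \<mu> d W T \<rho>' ys" by simp
      then have "emits \<mu> d W (btime b' M + T) \<rho>' ys" by (rule emits_mono) auto
      with False show ?thesis by simp
    qed
  qed (use BAnd.prems in auto)
  then show ?case by (simp add: add.assoc)
qed

lemma poly_bounded_btime: "poly_bounded (btime b)"
  by (induction b) (auto intro!: poly_bounded_intros)

lemma poly_bounded_sum: "(\<And>q. poly_bounded (T q)) \<Longrightarrow> poly_bounded (\<lambda>n. \<Sum>q<Q. T q n)" for Q :: nat
  by (induction Q) (auto intro!: poly_bounded_intros)

text \<open>This serves the direction from the class to general graphs.\<close>

lemma poly_time_computable_id: "poly_time_computable (\<lambda>x. x)"
proof (rule poly_time_computableI)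
  let ?c = "Ins (Const 2 1) ;; For 6 0 10 (Ins (Load 14 6) ;; Ins (Write 14))"
  show "poly_bounded (\<lambda>n. 1 + (n * ((1 + 1) + 4) + 3))"
    by (intro poly_bounded_intros)
  fix x
  let ?\<mu> = "mem (ram_init x)" let ?\<rho> = "(regs (ram_init x))(2 := 1)"
  have "emits ?\<mu> (For 6 0 10 (Ins (Load 14 6) ;; Ins (Write 14))) {6, 10, 14}
      (?\<rho> 0 * ((1 + 1) + 4) + 3) ?\<rho> (concat (map (\<lambda>i. [?\<mu> i \<noteq> 0]) [0..<?\<rho> 0]))"
  proof (rule emits_For[where W' = "{14}"], goal_cases)
    case (1 \<rho>')
    let ?\<rho>1 = "\<rho>'(14 := ?\<mu> (\<rho>' 6))"
    have "emits ?\<mu> (Ins (Write 14)) {14} 1 ?\<rho>1 [?\<rho>1 14 \<noteq> 0]" by (rule emits_Write)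
    then have "emits ?\<mu> (Ins (Write 14)) {14} 1 ?\<rho>1 [?\<mu> (\<rho>' 6) \<noteq> 0]" by simp
    then show ?case by (rule emits_exe_Seq[OF exe_Load, rotated]) auto
  qed (auto simp: ram_init_def)
  moreover have "concat (map (\<lambda>i. [?\<mu> i \<noteq> 0]) [0..<?\<rho> 0]) = x"
    by (rule nth_equalityI) (auto simp: ram_init_def concat_map_singleton)
  ultimately have "emits ?\<mu> (For 6 0 10 (Ins (Load 14 6) ;; Ins (Write 14))) {6, 10, 14}
      (length x * ((1 + 1) + 4) + 3) ?\<rho> x"
    by (simp add: ram_init_def)
  then obtain \<rho>' where "exe ?\<mu> (For 6 0 10 (Ins (Load 14 6) ;; Ins (Write 14))) ?\<rho>
      (length x * ((1 + 1) + 4) + 3) \<rho>' x"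
    unfolding emits_def by blast
  from exe_Seq[OF exe_Const this]
  show "\<exists>\<rho>'. exe ?\<mu> ?c (regs (ram_init x)) (1 + (length x * ((1 + 1) + 4) + 3)) \<rho>' x"
    by auto
qed


section \<open>The reduction\<close>

type_synonym vertex = "nat \<times> nat \<times> nat"

text \<open>
  Vertices are triples \<open>(q, u, v)\<close> in block \<open>q\<close>; block \<open>k < t\<close> carries the \<open>k\<close>-th vertices of the
  paths called \<open>chain\<close> below, and \<open>link\<close> joins a vertex of such a path to the next one. The blocks
  from \<open>t\<close> on consist of isolated vertices.
\<close>

fun link :: "nat \<Rightarrow> nat \<Rightarrow> (nat \<Rightarrow> nat \<Rightarrow> bool) \<Rightarrow> vertex \<Rightarrow> vertex \<Rightarrow> bool" where
  "link t n E (q, u, v) (q', u', v') \<longleftrightarrow>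
     q' < t \<and> q' = q + 1 \<and> u < n \<and>
     (u = u' \<and> v = (if q = 0 then 0 else v') \<and> (q' + 1 = t \<longrightarrow> \<not> (v' < u' \<and> E u' v')) \<or>
      q' + 1 = t \<and> u = v' \<and> v = (if q = 0 then 0 else u') \<and> u' < v' \<and> E u' v')"

definition flip_adj ::
  "(nat \<Rightarrow> nat \<Rightarrow> bool) \<Rightarrow> nat \<Rightarrow> nat \<Rightarrow> (nat \<Rightarrow> nat \<Rightarrow> bool) \<Rightarrow> vertex \<Rightarrow> vertex \<Rightarrow> bool" where
  "flip_adj F t n E x y \<longleftrightarrow>
     x \<noteq> y \<and> F (fst x) (fst y) \<noteq> (link t n E x y \<or> link t n E y x)"

section \<open>The output word as a function of the memory\<close>

definition vertices :: "nat \<Rightarrow> nat \<Rightarrow> vertex list" where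
  "vertices Q m =
     concat (map (\<lambda>q. concat (map (\<lambda>u. map (\<lambda>v. (q, u, v)) [0..<m]) [0..<m])) [0..<Q])"

definition word ::
  "nat \<Rightarrow> (nat \<Rightarrow> nat \<Rightarrow> bool) \<Rightarrow> nat \<Rightarrow> nat \<Rightarrow> (nat \<Rightarrow> nat \<Rightarrow> bool) \<Rightarrow> bool list" where
  "word Q F t n E = (let V = vertices Q (n + 3) in
     replicate (length V) True @ [False] @ concat (map (\<lambda>x. map (flip_adj F t n E x) V) V))"

definition ones :: "(nat \<Rightarrow> nat) \<Rightarrow> nat \<Rightarrow> nat" where
  "ones \<mu> b = (LEAST k. \<mu> (b + k) = 0)"

text \<open>The loops run up to n + 3 while the matrix has \<open>n\<close> columns; without the
  guard a larger coordinate would address a bit of another row or lie behind the matrix.\<close>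

definition matrix_at :: "(nat \<Rightarrow> nat) \<Rightarrow> nat \<Rightarrow> nat \<Rightarrow> nat \<Rightarrow> nat \<Rightarrow> bool" where
  "matrix_at \<mu> b n u v \<longleftrightarrow> u < n \<and> v < n \<and> \<mu> (b + v + u * n) \<noteq> 0"

definition word_at :: "nat \<Rightarrow> (nat \<Rightarrow> nat \<Rightarrow> bool) \<Rightarrow> nat \<Rightarrow> (nat \<Rightarrow> nat) \<Rightarrow> nat \<Rightarrow> bool list" where
  "word_at Q F t \<mu> b = word Q F t (ones \<mu> b) (matrix_at \<mu> (b + ones \<mu> b + 1) (ones \<mu> b))"

definition reduction :: "nat \<Rightarrow> (nat \<Rightarrow> nat \<Rightarrow> bool) \<Rightarrow> nat \<Rightarrow> bool list \<Rightarrow> bool list" where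
  "reduction Q F t x = (let \<mu> = mem (ram_init x); n = ones \<mu> 0 in
     word_at Q F t \<mu> 0 @ word_at Q F t \<mu> (n + 1 + n * n))"

section \<open>Adjacency as a Boolean expression over registers\<close>

definition BOr :: "bexp \<Rightarrow> bexp \<Rightarrow> bexp" where
  "BOr b b' = BNot (BAnd (BNot b) (BNot b'))"

definition edge_bexp :: "nat \<Rightarrow> nat \<Rightarrow> bexp" where
  "edge_bexp u v = BAnd (BLess u 3) (BAnd (BLess v 3) (BBit u v))"

text \<open>Conditions on block numbers are decided when the program is built, those on coordinates
  at run time. Register 1 stands in for the constant 0.\<close>

definition link_bexp :: "nat \<Rightarrow> nat \<Rightarrow> nat \<Rightarrow> nat \<Rightarrow> nat \<Rightarrow> nat \<Rightarrow> nat \<Rightarrow> bexp" where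
  "link_bexp t q q' u v u' v' =
     (if q' < t \<and> q' = q + 1 then
        BAnd (BLess u 3) (BOr
          (BAnd (BEq u u') (BAnd (BEq v (if q = 0 then 1 else v'))
             (if q' + 1 = t then BNot (BAnd (BLess v' u') (edge_bexp u' v')) else BConst True)))
          (if q' + 1 = t
           then BAnd (BEq u v') (BAnd (BEq v (if q = 0 then 1 else u'))
                  (BAnd (BLess u' v') (edge_bexp u' v')))
           else BConst False))
      else BConst False)"

definition adj_bexp :: "(nat \<Rightarrow> nat \<Rightarrow> bool) \<Rightarrow> nat \<Rightarrow> nat \<Rightarrow> nat \<Rightarrow> bexp" where
  "adj_bexp F t q q' = BAnd
     (if q = q' then BNot (BAnd (BEq 6 8) (BEq 7 9)) else BConst True)
     (let S = BOr (link_bexp t q q' 6 7 8 9) (link_bexp t q' q 8 9 6 7)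
      in if F q q' then BNot S else S)"

lemma beval_link_bexp:
  assumes "\<rho> 1 = 0"
  shows "beval \<mu> \<rho> (link_bexp t q q' u v u' v') \<longleftrightarrow>
    link t (\<rho> 3) (matrix_at \<mu> (\<rho> 4) (\<rho> 3)) (q, \<rho> u, \<rho> v) (q', \<rho> u', \<rho> v')"
  using assms by (auto simp: link_bexp_def BOr_def edge_bexp_def matrix_at_def)

lemma beval_adj_bexp:
  assumes "\<rho> 1 = 0"
  shows "beval \<mu> \<rho> (adj_bexp F t q q') \<longleftrightarrow>
    flip_adj F t (\<rho> 3) (matrix_at \<mu> (\<rho> 4) (\<rho> 3)) (q, \<rho> 6, \<rho> 7) (q', \<rho> 8, \<rho> 9)"
  using assms
  by (auto simp: adj_bexp_def flip_adj_def beval_link_bexp BOr_def Let_def simp del: link.simps)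

lemma bwf_adj_bexp: "bwf (adj_bexp F t q q')"
  by (auto simp: adj_bexp_def link_bexp_def BOr_def edge_bexp_def Let_def)

section \<open>Loops over all vertices and the matrix program\<close>

definition for_vertices :: "nat \<Rightarrow> nat \<Rightarrow> nat \<Rightarrow> nat \<Rightarrow> nat \<Rightarrow> (nat \<Rightarrow> com) \<Rightarrow> com" where
  "for_vertices Q u v d e c = seqs (\<lambda>q. For u 5 d (For v 5 e (c q))) Q"

definition for_time :: "nat \<Rightarrow> (nat \<Rightarrow> nat) \<Rightarrow> nat \<Rightarrow> nat" where
  "for_time Q T m = 1 + (\<Sum>q<Q. m * (m * (T q + 4) + 3 + 4) + 3)"

lemma concat_map_concat: "concat (map f (concat xss)) = concat (map (\<lambda>xs. concat (map f xs)) xss)"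
  by (induction xss) auto

lemma concat_map_vertices: "concat (map f (vertices Q m)) =
   concat (map (\<lambda>q. concat (map (\<lambda>u. concat (map (\<lambda>v. f (q, u, v)) [0..<m])) [0..<m])) [0..<Q])"
  by (simp add: vertices_def concat_map_concat comp_def)

lemma emits_for_vertices:
  assumes body: "\<And>q \<rho>'. q < Q \<Longrightarrow> (\<And>r. r \<notin> W \<Longrightarrow> \<rho>' r = \<rho> r) \<Longrightarrow>
      \<rho>' u < \<rho> 5 \<Longrightarrow> \<rho>' v < \<rho> 5 \<Longrightarrow> emits \<mu> (c q) W' (T q) \<rho>' (ys (q, \<rho>' u, \<rho>' v))"
    and W: "W' \<subseteq> W" "{u, v, d, e, 14} \<subseteq> W" "{u, v, d, e} \<inter> W' = {}" "1 \<notin> W" "2 \<notin> W" "5 \<notin> W"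
      "distinct [u, v, d, e, 14]"
    and \<rho>: "\<rho> 1 = 0" "\<rho> 2 = 1"
  shows "emits \<mu> (for_vertices Q u v d e c) W (for_time Q T (\<rho> 5)) \<rho>
     (concat (map ys (vertices Q (\<rho> 5))))"
  unfolding for_vertices_def for_time_def concat_map_vertices
proof (rule emits_seqs)
  let ?W = "insert v (insert e W')"
  fix q \<rho>1 assume q: "q < Q" and 1: "\<And>r. r \<notin> W \<Longrightarrow> \<rho>1 r = \<rho> r"
  have "emits \<mu> (For u 5 d (For v 5 e (c q))) W (\<rho>1 5 * ((\<rho>1 5 * (T q + 4) + 3) + 4) + 3) \<rho>1
     (concat (map (\<lambda>u. concat (map (\<lambda>v. ys (q, u, v)) [0..<\<rho>1 5])) [0..<\<rho>1 5]))"
  proof (rule emits_For[where W' = ?W])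
    fix \<rho>2 assume 2: "\<And>r. r \<notin> W \<Longrightarrow> \<rho>2 r = \<rho>1 r" "\<rho>2 u < \<rho>1 5"
    have "emits \<mu> (For v 5 e (c q)) ?W (\<rho>2 5 * (T q + 4) + 3) \<rho>2
       (concat (map (\<lambda>v. ys (q, \<rho>2 u, v)) [0..<\<rho>2 5]))"
    proof (rule emits_For[where W' = W'])
      fix \<rho>3 assume 3: "\<And>r. r \<notin> ?W \<Longrightarrow> \<rho>3 r = \<rho>2 r" "\<rho>3 v < \<rho>2 5"
      have "\<rho>3 r = \<rho> r" if "r \<notin> W" for r
      proof -
        have "r \<notin> ?W" using that W by auto
        then show ?thesis using 1 2 3 that by metis
      qed
      moreover have "\<rho>3 u = \<rho>2 u" using 3 W by auto
      moreover have "\<rho>2 u < \<rho> 5" "\<rho>3 v < \<rho> 5" using 1 2 3 W by auto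
      ultimately show "emits \<mu> (c q) W' (T q) \<rho>3 (ys (q, \<rho>2 u, \<rho>3 v))"
        using body[OF q, of \<rho>3] by simp
    qed (use 1 2 W \<rho> in auto)
    then show "emits \<mu> (For v 5 e (c q)) ?W (\<rho>1 5 * (T q + 4) + 3) \<rho>2
       (concat (map (\<lambda>v. ys (q, \<rho>2 u, v)) [0..<\<rho>1 5]))"
      using 2 W by simp
  qed (use 1 W \<rho> in auto)
  then show "emits \<mu> (For u 5 d (For v 5 e (c q))) W (\<rho> 5 * (\<rho> 5 * (T q + 4) + 3 + 4) + 3) \<rho>1
     (concat (map (\<lambda>u. concat (map (\<lambda>v. ys (q, u, v)) [0..<\<rho> 5])) [0..<\<rho> 5]))"
    using 1 W by simp
qed (use W in auto)

lemma poly_bounded_for_time: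
  assumes "\<And>q. poly_bounded (T q)" "poly_bounded M"
  shows "poly_bounded (\<lambda>n. for_time Q (\<lambda>q. T q n) (M n))"
  unfolding for_time_def
  by (intro poly_bounded_intros poly_bounded_sum assms)

lemma for_time_mono:
  assumes "\<And>q. T q \<le> T' q" "m \<le> m'"
  shows "for_time Q T m \<le> for_time Q T' m'"
  unfolding for_time_def using assms by (intro add_mono sum_mono mult_mono) auto

text \<open>Registers 2 and 1 hold 1 and 0, so writing them emits the bits true and false.\<close>

definition matrix_com :: "nat \<Rightarrow> (nat \<Rightarrow> nat \<Rightarrow> bool) \<Rightarrow> nat \<Rightarrow> com" where
  "matrix_com Q F t = for_vertices Q 6 7 10 11 (\<lambda>q. for_vertices Q 8 9 12 13
     (\<lambda>q'. test (adj_bexp F t q q') (Ins (Write 2)) (Ins (Write 1))))"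

definition matrix_time :: "nat \<Rightarrow> (nat \<Rightarrow> nat \<Rightarrow> bool) \<Rightarrow> nat \<Rightarrow> nat \<Rightarrow> nat" where
  "matrix_time Q F t m =
     for_time Q (\<lambda>q. for_time Q (\<lambda>q'. btime (adj_bexp F t q q') m + 1) m) m"

lemma emits_matrix_com:
  assumes "\<rho> 1 = 0" "\<rho> 2 = 1" "{6..16} \<subseteq> W" "W \<inter> {..5} = {}"
  shows "emits \<mu> (matrix_com Q F t) W (matrix_time Q F t (\<rho> 5)) \<rho>
     (concat (map (\<lambda>x. map (flip_adj F t (\<rho> 3) (matrix_at \<mu> (\<rho> 4) (\<rho> 3)) x)
        (vertices Q (\<rho> 5))) (vertices Q (\<rho> 5))))"
  unfolding matrix_com_def matrix_time_def
proof (rule emits_for_vertices[where W' = "{8, 9, 12, 13, 14, 15, 16}"], goal_cases)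
  case (1 q \<rho>1)
  have \<rho>1: "\<rho>1 r = \<rho> r" if "r \<in> {..5}" for r using that 1(2) assms(4) by auto
  have "emits \<mu> (for_vertices Q 8 9 12 13
     (\<lambda>q'. test (adj_bexp F t q q') (Ins (Write 2)) (Ins (Write 1)))) {8, 9, 12, 13, 14, 15, 16}
     (for_time Q (\<lambda>q'. btime (adj_bexp F t q q') (\<rho> 5) + 1) (\<rho>1 5)) \<rho>1
     (concat (map (\<lambda>y. [flip_adj F t (\<rho> 3) (matrix_at \<mu> (\<rho> 4) (\<rho> 3)) (q, \<rho>1 6, \<rho>1 7) y])
        (vertices Q (\<rho>1 5))))"
  proof (rule emits_for_vertices[where W' = "{14, 15, 16}"], goal_cases)
    case (1 q' \<rho>2)
    have \<rho>2: "\<rho>2 r = \<rho>1 r" if "r \<in> {..7}" for r using that 1(2) by auto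
    have eq: "beval \<mu> \<rho>2 (adj_bexp F t q q') \<longleftrightarrow>
        flip_adj F t (\<rho> 3) (matrix_at \<mu> (\<rho> 4) (\<rho> 3)) (q, \<rho>1 6, \<rho>1 7) (q', \<rho>2 8, \<rho>2 9)"
      using \<rho>1 \<rho>2 assms by (subst beval_adj_bexp) auto
    show ?case unfolding eq[symmetric]
    proof (rule emits_test)
      fix \<rho>3 :: "nat \<Rightarrow> nat" assume 3: "\<And>r. r \<notin> {14, 15, 16} \<Longrightarrow> \<rho>3 r = \<rho>2 r"
      have "\<rho>3 1 = 0" "\<rho>3 2 = 1" using 3 \<rho>1 \<rho>2 assms by auto
      then show "emits \<mu> (if beval \<mu> \<rho>2 (adj_bexp F t q q') then Ins (Write 2) else Ins (Write 1))
          {14, 15, 16} 1 \<rho>3 [beval \<mu> \<rho>2 (adj_bexp F t q q')]"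
        using emits_Write[of \<mu> 2 "{14, 15, 16}" \<rho>3] emits_Write[of \<mu> 1 "{14, 15, 16}" \<rho>3]
        by (auto split: if_splits)
    next
      fix r :: nat assume "r \<in> {6..<10}"
      then consider "r = 6" | "r = 7" | "r = 8" | "r = 9" by force
      then show "\<rho>2 r \<le> \<rho> 5" using 1(3,4) \<open>\<rho>1 6 < \<rho> 5\<close> \<open>\<rho>1 7 < \<rho> 5\<close> \<rho>1 \<rho>2 by cases auto
    qed (use \<rho>1 \<rho>2 assms bwf_adj_bexp in auto)
  qed (use \<rho>1 assms in auto)
  moreover have "\<rho>1 5 = \<rho> 5" using \<rho>1 by simp
  ultimately show ?case by (simp add: concat_map_singleton)
qed (use assms in auto)

lemma poly_bounded_matrix_time: "poly_bounded (matrix_time Q F t)"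
  unfolding matrix_time_def
  by (intro poly_bounded_for_time poly_bounded_intros poly_bounded_btime)

section \<open>Parsing the input and the complete program\<close>

definition scan_com :: com where
  "scan_com = While 14 (Ins (Add 3 3 2) ;; Ins (Add 4 4 2) ;; Ins (Load 14 4))"

lemma exe_scan_com:
  assumes "\<forall>i<k. \<mu> (\<rho> 4 + i) \<noteq> 0" "\<mu> (\<rho> 4 + k) = 0" "\<rho> 14 = \<mu> (\<rho> 4)" "\<rho> 1 = 0" "\<rho> 2 = 1"
  shows "exe \<mu> scan_com \<rho> (5 * k + 1) (\<rho>(3 := \<rho> 3 + k, 4 := \<rho> 4 + k, 14 := 0)) []"
  using assms
proof (induction k arbitrary: \<rho>)
  case 0
  then have "\<rho>(3 := \<rho> 3 + 0, 4 := \<rho> 4 + 0, 14 := 0) = \<rho>" by auto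
  then show ?case using exe_While_zero[of \<rho> 14] 0 by (simp add: scan_com_def)
next
  case (Suc k)
  let ?\<rho>1 = "\<rho>(3 := \<rho> 3 + \<rho> 2)" let ?\<rho>2 = "?\<rho>1(4 := ?\<rho>1 4 + ?\<rho>1 2)"
  let ?\<rho>3 = "?\<rho>2(14 := \<mu> (?\<rho>2 4))"
  let ?b = "Ins (Add 3 3 2) ;; Ins (Add 4 4 2) ;; Ins (Load 14 4)"
  have 1: "exe \<mu> ?b \<rho> (1 + (1 + 1)) ?\<rho>3 ([] @ [] @ [])"
    by (rule exe_Seq[OF exe_Add exe_Seq[OF exe_Add exe_Load]])
  have ih: "exe \<mu> scan_com ?\<rho>3 (5 * k + 1) (?\<rho>3(3 := ?\<rho>3 3 + k, 4 := ?\<rho>3 4 + k, 14 := 0)) []"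
  proof (rule Suc.IH)
    show "\<forall>i<k. \<mu> (?\<rho>3 4 + i) \<noteq> 0"
    proof (intro allI impI)
      fix i assume "i < k"
      then have "\<mu> (\<rho> 4 + Suc i) \<noteq> 0" using Suc.prems(1) by blast
      then show "\<mu> (?\<rho>3 4 + i) \<noteq> 0" using Suc.prems(5) by simp
    qed
  qed (use Suc.prems in auto)
  have nz: "\<rho> 14 \<noteq> 0" using Suc.prems(1)[rule_format, of 0] Suc.prems(3) by simp
  have "exe \<mu> scan_com \<rho> ((1 + (1 + 1)) + (5 * k + 1) + 2)
      (?\<rho>3(3 := ?\<rho>3 3 + k, 4 := ?\<rho>3 4 + k, 14 := 0)) (([] @ [] @ []) @ [])"
    unfolding scan_com_def
    by (rule exe_While_nonzero[OF 1 nz _ ih[unfolded scan_com_def]]) (use Suc.prems in auto)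
  moreover have "?\<rho>3(3 := ?\<rho>3 3 + k, 4 := ?\<rho>3 4 + k, 14 := 0) =
      \<rho>(3 := \<rho> 3 + Suc k, 4 := \<rho> 4 + Suc k, 14 := 0)"
    using Suc.prems by (auto simp: fun_eq_iff)
  moreover have "(1 + (1 + 1)) + (5 * k + 1) + 2 = 5 * Suc k + 1" by simp
  ultimately show ?case by (simp only: append_Nil)
qed

definition parse_com :: com where
  "parse_com = Ins (Const 3 0) ;; Ins (Load 14 4) ;; scan_com ;; Ins (Add 4 4 2) ;;
     Ins (Const 5 3) ;; Ins (Add 5 5 3)"

lemma exe_parse_com:
  assumes "\<exists>k. \<mu> (\<rho> 4 + k) = 0" "\<rho> 1 = 0" "\<rho> 2 = 1"
  defines "n \<equiv> ones \<mu> (\<rho> 4)"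
  shows "exe \<mu> parse_com \<rho> (5 * n + 6) (\<rho>(3 := n, 4 := \<rho> 4 + n + 1, 5 := n + 3, 14 := 0)) []"
proof -
  have n: "\<mu> (\<rho> 4 + n) = 0" "\<forall>i<n. \<mu> (\<rho> 4 + i) \<noteq> 0"
    unfolding n_def ones_def using LeastI_ex[OF assms(1)] not_less_Least by blast+
  let ?\<rho>1 = "\<rho>(3 := 0)" let ?\<rho>2 = "?\<rho>1(14 := \<mu> (?\<rho>1 4))"
  let ?\<rho>3 = "?\<rho>2(3 := ?\<rho>2 3 + n, 4 := ?\<rho>2 4 + n, 14 := 0)"
  let ?\<rho>4 = "?\<rho>3(4 := ?\<rho>3 4 + ?\<rho>3 2)" let ?\<rho>5 = "?\<rho>4(5 := 3)" let ?\<rho>6 = "?\<rho>5(5 := ?\<rho>5 5 + ?\<rho>5 3)"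
  have 3: "exe \<mu> scan_com ?\<rho>2 (5 * n + 1) ?\<rho>3 []"
    by (rule exe_scan_com) (use n assms in auto)
  have "exe \<mu> parse_com \<rho> (1 + (1 + ((5 * n + 1) + (1 + (1 + 1))))) ?\<rho>6 ([] @ [] @ [] @ [] @ [] @ [])"
    unfolding parse_com_def
    by (rule exe_Seq[OF exe_Const exe_Seq[OF exe_Load exe_Seq[OF 3
      exe_Seq[OF exe_Add exe_Seq[OF exe_Const exe_Add]]]]])
  moreover have "?\<rho>6 = \<rho>(3 := n, 4 := \<rho> 4 + n + 1, 5 := n + 3, 14 := 0)"
    using assms by (auto simp: fun_eq_iff)
  moreover have "1 + (1 + ((5 * n + 1) + (1 + (1 + 1)))) = 5 * n + 6" by simp
  ultimately show ?thesis by (simp only: append_Nil)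
qed

text \<open>The same code serves both graphs of an instance: the final \<open>add_prod 4 3\<close>
  moves the read address past the n * n matrix entries, to where the second code begins.\<close>

definition phase_com :: "nat \<Rightarrow> (nat \<Rightarrow> nat \<Rightarrow> bool) \<Rightarrow> nat \<Rightarrow> com" where
  "phase_com Q F t = parse_com ;;
     (for_vertices Q 6 7 10 11 (\<lambda>_. Ins (Write 2)) ;; Ins (Write 1) ;; matrix_com Q F t) ;;
     add_prod 4 3"

definition phase_time :: "nat \<Rightarrow> (nat \<Rightarrow> nat \<Rightarrow> bool) \<Rightarrow> nat \<Rightarrow> nat \<Rightarrow> nat" where
  "phase_time Q F t n = (5 * n + 6) +
     ((for_time Q (\<lambda>_. 1) (n + 3) + (1 + matrix_time Q F t (n + 3))) + (4 * n + 2))"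

lemma exe_phase_com:
  assumes "\<exists>k. \<mu> (\<rho> 4 + k) = 0" "\<rho> 1 = 0" "\<rho> 2 = 1"
  defines "n \<equiv> ones \<mu> (\<rho> 4)"
  shows "\<exists>\<rho>'. exe \<mu> (phase_com Q F t) \<rho> (phase_time Q F t n) \<rho>' (word_at Q F t \<mu> (\<rho> 4)) \<and>
     \<rho>' 1 = 0 \<and> \<rho>' 2 = 1 \<and> \<rho>' 4 = \<rho> 4 + n + 1 + n * n"
proof -
  let ?\<rho>1 = "\<rho>(3 := n, 4 := \<rho> 4 + n + 1, 5 := n + 3, 14 := 0)"
  let ?V = "vertices Q (?\<rho>1 5)"
  have 1: "exe \<mu> parse_com \<rho> (5 * n + 6) ?\<rho>1 []"
    unfolding n_def by (rule exe_parse_com) (use assms in auto)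
  have "emits \<mu> (for_vertices Q 6 7 10 11 (\<lambda>_. Ins (Write 2)) ;; Ins (Write 1) ;; matrix_com Q F t)
      {6..16} (for_time Q (\<lambda>_. 1) (?\<rho>1 5) + (1 + matrix_time Q F t (?\<rho>1 5))) ?\<rho>1
      (concat (map (\<lambda>_. [True]) ?V) @ [False] @
        concat (map (\<lambda>x. map (flip_adj F t (?\<rho>1 3) (matrix_at \<mu> (?\<rho>1 4) (?\<rho>1 3)) x) ?V) ?V))"
  proof (rule emits_Seq, goal_cases)
    case 1
    show ?case
    proof (rule emits_for_vertices[where W' = "{}"], goal_cases)
      case (1 q \<rho>')
      have "\<rho>' 2 = 1" using 1(2)[of 2] assms by simp
      then show ?case using emits_Write[of \<mu> 2 "{}" \<rho>'] by simp
    qed (use assms in auto)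
  next
    case (2 \<rho>2)
    show ?case
    proof (rule emits_Seq, goal_cases)
      case 1
      have "\<rho>2 1 = 0" using 2[of 1] assms by simp
      then show ?case using emits_Write[of \<mu> 1 "{6..16}" \<rho>2] by simp
    next
      case (2 \<rho>3)
      have \<rho>3: "\<rho>3 r = ?\<rho>1 r" if "r \<le> 5" for r
        using 2[of r] \<open>\<And>r. r \<notin> {6..16} \<Longrightarrow> \<rho>2 r = ?\<rho>1 r\<close>[of r] that by simp
      have "emits \<mu> (matrix_com Q F t) {6..16} (matrix_time Q F t (\<rho>3 5)) \<rho>3
        (concat (map (\<lambda>x. map (flip_adj F t (\<rho>3 3) (matrix_at \<mu> (\<rho>3 4) (\<rho>3 3)) x)
           (vertices Q (\<rho>3 5))) (vertices Q (\<rho>3 5))))"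
        by (rule emits_matrix_com) (use assms \<rho>3[of 1] \<rho>3[of 2] in auto)
      moreover have "\<rho>3 3 = ?\<rho>1 3" "\<rho>3 4 = ?\<rho>1 4" "\<rho>3 5 = ?\<rho>1 5" by (rule \<rho>3; simp)+
      ultimately show ?case by simp
    qed
  qed
  moreover have "concat (map (\<lambda>_. [True]) ?V) @ [False] @
        concat (map (\<lambda>x. map (flip_adj F t (?\<rho>1 3) (matrix_at \<mu> (?\<rho>1 4) (?\<rho>1 3)) x) ?V) ?V) =
      word_at Q F t \<mu> (\<rho> 4)"
    by (simp add: word_at_def word_def Let_def concat_map_singleton map_replicate_const n_def)
  ultimately obtain \<rho>2 where 2: "exe \<mu> (for_vertices Q 6 7 10 11 (\<lambda>_. Ins (Write 2)) ;; Ins (Write 1) ;;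
      matrix_com Q F t) ?\<rho>1 (for_time Q (\<lambda>_. 1) (n + 3) + (1 + matrix_time Q F t (n + 3))) \<rho>2
      (word_at Q F t \<mu> (\<rho> 4))" "\<forall>r. r \<notin> {6..16} \<longrightarrow> \<rho>2 r = ?\<rho>1 r"
    unfolding emits_def by auto
  have \<rho>2: "\<rho>2 1 = 0" "\<rho>2 2 = 1" "\<rho>2 3 = n" "\<rho>2 4 = \<rho> 4 + n + 1"
    using 2(2) assms by auto
  have 3: "exe \<mu> (add_prod 4 3) \<rho>2 (4 * \<rho>2 3 + 2) (\<rho>2(16 := 0, 4 := \<rho>2 4 + \<rho>2 3 * \<rho>2 3)) []"
    by (rule exe_add_prod) (use \<rho>2 in auto)
  then have 3: "exe \<mu> (add_prod 4 3) \<rho>2 (4 * n + 2) (\<rho>2(16 := 0, 4 := \<rho>2 4 + \<rho>2 3 * \<rho>2 3)) []"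
    by (simp only: \<rho>2(3))
  have "exe \<mu> (phase_com Q F t) \<rho> (phase_time Q F t n) (\<rho>2(16 := 0, 4 := \<rho>2 4 + \<rho>2 3 * \<rho>2 3))
      ([] @ word_at Q F t \<mu> (\<rho> 4) @ [])"
    unfolding phase_com_def phase_time_def
    by (rule exe_Seq[OF 1 exe_Seq[OF 2(1) 3]])
  then show ?thesis using \<rho>2
    by (intro exI[of _ "\<rho>2(16 := 0, 4 := \<rho>2 4 + \<rho>2 3 * \<rho>2 3)"]) auto
qed

lemma phase_time_mono: "n \<le> n' \<Longrightarrow> phase_time Q F t n \<le> phase_time Q F t n'"
proof -
  have b: "btime b m \<le> btime b m'" if "m \<le> m'" for b m m'
    using that by (induction b) auto
  show "n \<le> n' \<Longrightarrow> ?thesis"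
    unfolding phase_time_def matrix_time_def by (intro add_mono for_time_mono b) auto
qed

lemma poly_bounded_phase_time: "poly_bounded (phase_time Q F t)"
proof -
  obtain q where "matrix_time Q F t n \<le> poly q n" for n
    using poly_bounded_matrix_time[of Q F t] unfolding poly_bounded_def by blast
  then have "poly_bounded (\<lambda>n. matrix_time Q F t (n + 3))"
    \<comment> \<open>Composition with the polynomial n + 3 accounts for the range of the
      loops.\<close>
    unfolding poly_bounded_def by (intro exI[of _ "pcompose q [:3, 1:]"]) (auto simp: poly_pcompose add.commute)
  then show ?thesis
    unfolding phase_time_def by (intro poly_bounded_for_time poly_bounded_intros)
qed

text \<open>Cell \<open>b + length x\<close> lies beyond the input and is 0. So the parsed number of
  vertices is at most the input length for every word, and \<open>phase_time_mono\<close> turns this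
  into a time bound.\<close>

lemma ones_le: "ones (mem (ram_init x)) b \<le> length x"
  unfolding ones_def by (rule Least_le) (simp add: ram_init_def)

lemma ones_exists: "\<exists>k. mem (ram_init x) (b + k) = 0"
  by (rule exI[of _ "length x"]) (simp add: ram_init_def)

theorem poly_time_computable_reduction: "poly_time_computable (reduction Q F t)"
proof (rule poly_time_computableI)
  let ?c = "Ins (Const 2 1) ;; phase_com Q F t ;; phase_com Q F t"
  show "poly_bounded (\<lambda>n. 1 + (phase_time Q F t n + phase_time Q F t n))"
    by (intro poly_bounded_intros poly_bounded_phase_time)
  fix x
  let ?\<mu> = "mem (ram_init x)" let ?\<rho> = "(regs (ram_init x))(2 := 1)" let ?n = "ones ?\<mu> 0"
  have \<rho>: "?\<rho> 1 = 0" "?\<rho> 2 = 1" "?\<rho> 4 = 0" by (auto simp: ram_init_def)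
  obtain \<rho>1 where 1: "exe ?\<mu> (phase_com Q F t) ?\<rho> (phase_time Q F t ?n) \<rho>1 (word_at Q F t ?\<mu> 0)"
      "\<rho>1 1 = 0" "\<rho>1 2 = 1" "\<rho>1 4 = ?n + 1 + ?n * ?n"
    using exe_phase_com[of ?\<mu> ?\<rho> Q F t, OF ones_exists \<rho>(1,2)] unfolding \<rho>(3) by auto
  obtain \<rho>2 where 2: "exe ?\<mu> (phase_com Q F t) \<rho>1 (phase_time Q F t (ones ?\<mu> (\<rho>1 4))) \<rho>2
      (word_at Q F t ?\<mu> (?n + 1 + ?n * ?n))"
    using exe_phase_com[of ?\<mu> \<rho>1 Q F t, OF ones_exists 1(2,3)] unfolding 1(4) by auto
  have "exe ?\<mu> ?c (regs (ram_init x))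
     (1 + (phase_time Q F t (length x) + phase_time Q F t (length x))) \<rho>2
     ([] @ word_at Q F t ?\<mu> 0 @ word_at Q F t ?\<mu> (?n + 1 + ?n * ?n))"
    by (rule exe_Seq[OF exe_Const exe_Seq[OF exe_mono[OF 1(1)] exe_mono[OF 2]]])
       (intro phase_time_mono ones_le)+
  then show "\<exists>\<rho>'. exe ?\<mu> ?c (regs (ram_init x))
     (1 + (phase_time Q F t (length x) + phase_time Q F t (length x))) \<rho>' (reduction Q F t x)"
    by (auto simp: reduction_def Let_def)
qed


section \<open>The graph of subdivided edges\<close>

definition sorted_edge :: "(nat \<Rightarrow> nat \<Rightarrow> bool) \<Rightarrow> nat \<Rightarrow> nat \<Rightarrow> nat \<times> nat" where
  "sorted_edge E u v = (if E u v \<and> v < u then (v, u) else (u, v))"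

text \<open>
  The path from \<open>u\<close> towards \<open>v\<close>. Its last vertex is shared with the path from \<open>v\<close> towards \<open>u\<close>
  exactly if \<open>u\<close> and \<open>v\<close> are adjacent.
\<close>

definition chain :: "nat \<Rightarrow> (nat \<Rightarrow> nat \<Rightarrow> bool) \<Rightarrow> nat \<Rightarrow> nat \<Rightarrow> nat \<Rightarrow> vertex" where
  "chain t E k u v =
     (if k = 0 then (0, u, 0) else if k + 1 = t then (k, sorted_edge E u v) else (k, u, v))"

definition vset :: "nat \<Rightarrow> nat \<Rightarrow> vertex set" where
  "vset Q m = {..<Q} \<times> {..<m} \<times> {..<m}"

lemma set_vertices: "set (vertices Q m) = vset Q m"
  by (auto simp: vertices_def vset_def image_iff)

lemma finite_vset: "finite (vset Q m)"
  by (simp add: vset_def)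

lemma card_vset: "card (vset Q m) = Q * m\<^sup>2"
  by (simp add: vset_def power2_eq_square)

section \<open>Paths and links\<close>

locale path_graph =
  fixes t n m Q :: nat and E :: "nat \<Rightarrow> nat \<Rightarrow> bool"
  assumes t: "2 \<le> t" "t \<le> Q" and m: "n \<le> m" "3 \<le> m"
    and E_sym: "E u v \<Longrightarrow> E v u" and E_irrefl: "\<not> E u u" and E_less: "E u v \<Longrightarrow> u < n"
begin

abbreviation "ch \<equiv> chain t E"

definition near :: "vertex \<Rightarrow> vertex \<Rightarrow> bool" where
  "near x y \<longleftrightarrow> x \<in> vset Q m \<and> y \<in> vset Q m \<and> (link t n E x y \<or> link t n E y x)"

lemma E_less': "E u v \<Longrightarrow> v < n"
  using E_sym E_less by blast

lemma fst_chain [simp]: "fst (ch k u v) = k"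
  by (simp add: chain_def)

text \<open>\<open>link\<close> is spelled out in coordinates so that a program can test it; the
  proofs use this view by paths instead. The second disjunct of \<open>link\<close> is the last step
  of the path from the larger of two adjacent vertices, whose own end gives way to the sorted
  pair.\<close>

lemma link_iff: "link t n E x y \<longleftrightarrow> (\<exists>k u v. k + 1 < t \<and> u < n \<and> x = ch k u v \<and> y = ch (k + 1) u v)"
proof
  assume l: "link t n E x y"
  obtain q u v q' u' v' where xy: "x = (q, u, v)" "y = (q', u', v')" by (cases x, cases y) auto
  have q: "q' < t" "q' = q + 1" "u < n" using l xy by auto
  consider "u = u'" "v = (if q = 0 then 0 else v')" "q' + 1 = t \<longrightarrow> \<not> (v' < u' \<and> E u' v')"
    | "q' + 1 = t" "u = v'" "v = (if q = 0 then 0 else u')" "u' < v'" "E u' v'"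
    using l xy by auto
  \<comment> \<open>The path leads from \<open>u\<close> towards the other component of the pair
    (u', v').\<close>
  then have "x = ch q u (if u = u' then v' else u') \<and> y = ch (q + 1) u (if u = u' then v' else u')"
  proof cases
    case 1
    then show ?thesis using xy q by (auto simp: chain_def sorted_edge_def)
  next
    case 2
    then show ?thesis using xy q E_sym[of u' v'] by (auto simp: chain_def sorted_edge_def)
  qed
  with q show "\<exists>k u v. k + 1 < t \<and> u < n \<and> x = ch k u v \<and> y = ch (k + 1) u v"
    by (intro exI[of _ q] exI[of _ u] exI[of _ "if u = u' then v' else u'"]) simp
next
  assume "\<exists>k u v. k + 1 < t \<and> u < n \<and> x = ch k u v \<and> y = ch (k + 1) u v"
  then obtain k u v where k: "k + 1 < t" "u < n" "x = ch k u v" "y = ch (k + 1) u v" by blast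
  then show "link t n E x y"
    using E_sym[of u v] by (auto simp: chain_def sorted_edge_def)
qed

lemma chain_eqD:
  assumes "ch k u v = ch k' u' v'" "k < t"
  shows "k' = k" "k + 1 < t \<Longrightarrow> u' = u" "u' = u \<or> E u v \<and> u' = v \<and> k + 1 = t"
proof -
  show 1: "k' = k" using assms(1) by (metis fst_chain)
  show "k + 1 < t \<Longrightarrow> u' = u" "u' = u \<or> E u v \<and> u' = v \<and> k + 1 = t"
    using assms t E_sym unfolding 1
    by (auto simp: chain_def sorted_edge_def split: if_splits)
qed

lemma chain_in_vset: "k < t \<Longrightarrow> u < n \<Longrightarrow> v < m \<Longrightarrow> ch k u v \<in> vset Q m"
  using t m by (auto simp: vset_def chain_def sorted_edge_def)

lemma near_sym: "near x y \<Longrightarrow> near y x"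
  by (auto simp: near_def)

lemma near_chain: "k + 1 < t \<Longrightarrow> u < n \<Longrightarrow> v < m \<Longrightarrow> near (ch k u v) (ch (k + 1) u v)"
  unfolding near_def using link_iff chain_in_vset by auto

lemma link_down: "link t n E x (k, a, b) \<Longrightarrow> x = ch (k - 1) a b \<or> k + 1 = t \<and> x = ch (k - 1) b a"
  by (cases x) (auto simp: chain_def)

lemma link_up: "link t n E (k, a, b) z \<Longrightarrow> 0 < k \<Longrightarrow> z = ch (k + 1) a b"
proof -
  assume "link t n E (k, a, b) z" "0 < k"
  then obtain u v where "k + 1 < t" "(k, a, b) = ch k u v" "z = ch (k + 1) u v"
    unfolding link_iff by (metis fst_chain fst_conv)
  with \<open>0 < k\<close> show ?thesis by (auto simp: chain_def)
qed

section \<open>Walks between original vertices\<close>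

text \<open>The potential is \<open>d + k\<close>, steps plus height: a step up raises it by 2, a
  step down keeps it. The paths of \<open>u\<close> can be left only through a merged end, at height
  t - 1 after at least t - 1 steps, so the potential is at least 2 (t - 1) from then on. While the
  walk only descends from that end it is on a path of a neighbour of \<open>u\<close>; going up
  again makes the inequality strict, and it stays strict for ever.\<close>

lemma walk_invariant:
  assumes "((0, u, 0), x) \<in> {(x, y). near x y} ^^ d"
  shows "\<exists>k a b. x = ch k a b \<and> k < t \<and>
    (a = u \<and> k \<le> d \<or> E u a \<and> k + 1 < t \<and> 2 * (t - 1) \<le> d + k \<or> 2 * (t - 1) < d + k)"
  using assms
proof (induction d arbitrary: x)
  case 0
  then show ?case using t by (intro exI[of _ 0] exI[of _ u]) (auto simp: chain_def)
next
  case (Suc d)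
  then obtain y where y: "((0, u, 0), y) \<in> {(x, y). near x y} ^^ d" "near y x" by auto
  from Suc.IH[OF y(1)] obtain k a b where k: "y = ch k a b" "k < t"
    and d: "a = u \<and> k \<le> d \<or> E u a \<and> k + 1 < t \<and> 2 * (t - 1) \<le> d + k \<or> 2 * (t - 1) < d + k"
    by blast
  from y(2) consider "link t n E y x" | "link t n E x y" unfolding near_def by blast
  then show ?case
  proof cases
    case 1
    then obtain j a' b' where j: "j + 1 < t" "y = ch j a' b'" "x = ch (j + 1) a' b'"
      unfolding link_iff by blast
    have jk: "j = k" using chain_eqD(1)[of k a b j a' b'] j k by metis
    then have "a' = a" using chain_eqD(2)[of k a b j a' b'] j k by metis
    with j jk d show ?thesis by (intro exI[of _ "k + 1"] exI[of _ a] exI[of _ b']) auto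
  next
    case 2
    then obtain j a' b' where j: "j + 1 < t" "x = ch j a' b'" "y = ch (j + 1) a' b'"
      unfolding link_iff by blast
    have jk: "j + 1 = k" using chain_eqD(1)[of k a b "j + 1" a' b'] j k by metis
    have "a' = a \<or> E a b \<and> a' = b \<and> k + 1 = t"
      using chain_eqD(3)[of k a b "j + 1" a' b'] j k by metis
    then show ?thesis
    proof
      assume "a' = a"
      with j jk d k show ?thesis by (intro exI[of _ j] exI[of _ a] exI[of _ b']) auto
    next
      assume "E a b \<and> a' = b \<and> k + 1 = t"
      with j jk d k show ?thesis by (intro exI[of _ j] exI[of _ b] exI[of _ b']) auto
    qed
  qed
qed

lemma walk_up:
  assumes "k < t" "u < n" "v < m"
  shows "(ch 0 u v, ch k u v) \<in> {(x, y). near x y} ^^ k"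
  using assms(1)
proof (induction k)
  case (Suc k)
  then show ?case using near_chain[of k u v] assms by auto
qed auto

lemma walk_down:
  assumes "k < t" "u < n" "v < m"
  shows "(ch k u v, ch 0 u v) \<in> {(x, y). near x y} ^^ k"
  using assms(1)
proof (induction k)
  case (Suc k)
  then have "(ch (Suc k) u v, ch k u v) \<in> {(x, y). near x y}"
    using near_sym[OF near_chain[of k u v]] assms by auto
  with Suc show ?case by (meson Suc_lessD relpow_Suc_I2)
qed auto

text \<open>The length is the least possible one: with \<open>k = 0\<close> and
  \<open>d = 2 * (t - 1)\<close> the strict case of \<open>walk_invariant\<close> is void. The case
  of a walk that returns to \<open>u\<close> is ruled out by \<open>u \<noteq> v\<close>.\<close>

lemma edge_iff_walk:
  assumes "u < n" "u \<noteq> v"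
  shows "E u v \<longleftrightarrow> ((0, u, 0), (0, v, 0)) \<in> {(x, y). near x y} ^^ (2 * (t - 1))"
proof
  assume e: "E u v"
  have "ch (t - 1) u v = ch (t - 1) v u"
    using e E_sym[OF e] E_irrefl t by (auto simp: chain_def sorted_edge_def)
  moreover have "(ch 0 u v, ch (t - 1) u v) \<in> {(x, y). near x y} ^^ (t - 1)"
    "(ch (t - 1) v u, ch 0 v u) \<in> {(x, y). near x y} ^^ (t - 1)"
    using t m E_less[OF e] E_less'[OF e] by (auto intro!: walk_up walk_down)
  ultimately have "(ch 0 u v, ch 0 v u) \<in> {(x, y). near x y} ^^ ((t - 1) + (t - 1))"
    unfolding relpow_add by auto
  then show "((0, u, 0), (0, v, 0)) \<in> {(x, y). near x y} ^^ (2 * (t - 1))"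
    by (simp add: chain_def mult_2)
next
  assume "((0, u, 0), (0, v, 0)) \<in> {(x, y). near x y} ^^ (2 * (t - 1))"
  from walk_invariant[OF this] obtain k a b where k: "(0, v, 0) = ch k a b"
    "a = u \<and> k \<le> 2 * (t - 1) \<or> E u a \<and> k + 1 < t \<and> 2 * (t - 1) \<le> 2 * (t - 1) + k \<or>
     2 * (t - 1) < 2 * (t - 1) + k" by blast
  from k(1) have "k = 0" by (metis fst_chain fst_conv)
  with k(1) have "a = v" by (simp add: chain_def)
  with k \<open>k = 0\<close> assms show "E u v" by auto
qed

section \<open>Neighbourhoods in the subdivision\<close>

definition nbrs :: "vertex \<Rightarrow> vertex set" where
  "nbrs x = {y. near x y}"

lemma nbrs_inner:
  assumes "0 < k"
  shows "nbrs (k, a, b) \<subseteq> {ch (k - 1) a b, if k + 1 = t then ch (k - 1) b a else ch (k + 1) a b}"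
proof
  fix y assume "y \<in> nbrs (k, a, b)"
  then consider "link t n E y (k, a, b)" | "link t n E (k, a, b) y"
    unfolding nbrs_def near_def by blast
  then show "y \<in> {ch (k - 1) a b, if k + 1 = t then ch (k - 1) b a else ch (k + 1) a b}"
  proof cases
    case 1
    from link_down[OF this] show ?thesis by auto
  next
    case 2
    then have "k + 1 < t" by (cases y) auto
    with link_up[OF 2 assms] show ?thesis by auto
  qed
qed

lemma card_nbrs_inner:
  assumes "0 < k"
  shows "card (nbrs (k, a, b)) \<le> 2"
proof -
  have "card (nbrs (k, a, b)) \<le>
      card {ch (k - 1) a b, if k + 1 = t then ch (k - 1) b a else ch (k + 1) a b}"
    by (rule card_mono) (use nbrs_inner[OF assms] in auto)
  also have "\<dots> \<le> 2" by (simp add: card_insert_if)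
  finally show ?thesis .
qed

lemma nbrs_outer:
  assumes "y \<in> nbrs (0, a, b)"
  shows "a < n \<and> b = 0 \<and> y \<in> ch 1 a ` {..<m}"
proof -
  have V: "y \<in> vset Q m" and "link t n E (0, a, b) y \<or> link t n E y (0, a, b)"
    using assms unfolding nbrs_def near_def by auto
  \<comment> \<open>There is no block below block 0.\<close>
  then have "link t n E (0, a, b) y" by (cases y) auto
  then obtain k u v where "u < n" "(0, a, b) = ch k u v" "y = ch (k + 1) u v"
    unfolding link_iff by blast
  moreover from this have "k = 0" by (metis fst_chain fst_conv)
  ultimately have ab: "a < n" "b = 0" "y = ch 1 a v" by (auto simp: chain_def)
  \<comment> \<open>\<open>v\<close> is one of the coordinates of the vertex \<open>y\<close>, in
    whichever order they are sorted.\<close>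
  moreover have "v < m"
    using V ab(3) m by (auto simp: chain_def sorted_edge_def vset_def split: if_splits)
  ultimately show ?thesis by auto
qed

text \<open>The paths out of \<open>u\<close> separate in block 1. This remains true for t = 2,
  where block 1 consists of sorted pairs already: once \<open>u\<close> is known, either order of
  the pair reveals \<open>v\<close>.\<close>

lemma card_nbrs_origin:
  assumes "u < n"
  shows "card (nbrs (0, u, 0)) = m"
proof -
  have "ch 0 u v = (0, u, 0)" for v by (simp add: chain_def)
  then have "ch 1 u ` {..<m} \<subseteq> nbrs (0, u, 0)"
    using near_chain[of 0 u] t assms unfolding nbrs_def by fastforce
  then have "nbrs (0, u, 0) = ch 1 u ` {..<m}" using nbrs_outer by blast
  moreover have "inj_on (ch 1 u) {..<m}"
    by (rule inj_onI) (auto simp: chain_def sorted_edge_def split: if_splits)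
  ultimately show ?thesis by (simp add: card_image)
qed

lemma card_nbrs_le: "card (nbrs x) \<le> m"
proof (cases x)
  case (fields k a b)
  show ?thesis
  proof (cases "k = 0")
    case True
    then have "nbrs x \<subseteq> ch 1 a ` {..<m}" using nbrs_outer fields by blast
    then have "card (nbrs x) \<le> card (ch 1 a ` {..<m})" by (intro card_mono) auto
    also have "\<dots> \<le> m" using card_image_le[of "{..<m}" "ch 1 a"] by simp
    finally show ?thesis .
  next
    case False
    then show ?thesis using card_nbrs_inner[of k a b] m fields by simp
  qed
qed

lemma origin_iff_card_nbrs: "(\<exists>u<n. x = (0, u, 0)) \<longleftrightarrow> 3 \<le> card (nbrs x)"
proof
  assume "\<exists>u<n. x = (0, u, 0)"
  then show "3 \<le> card (nbrs x)" using card_nbrs_origin m by auto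
next
  assume 3: "3 \<le> card (nbrs x)"
  obtain k a b where x: "x = (k, a, b)" by (cases x) auto
  have "k = 0" using card_nbrs_inner[of k a b] 3 x by force
  moreover have "nbrs x \<noteq> {}" using 3 by auto
  then obtain y where "y \<in> nbrs x" by blast
  ultimately show "\<exists>u<n. x = (0, u, 0)" using nbrs_outer x by auto
qed

lemma nbrs_subset: "nbrs x \<subseteq> vset Q m"
  by (auto simp: nbrs_def near_def)

lemma finite_nbrs: "finite (nbrs x)"
  using nbrs_subset finite_vset finite_subset by metis

end


section \<open>Isomorphisms between flipped path graphs\<close>

text \<open>
  Class \<open>k\<close> gets \<open>2\<^sup>k\<close> blocks, so that the number of blocks in a union of classes determines
  which classes these are.
\<close>

definition class_list :: "nat \<Rightarrow> nat list" where
  "class_list t = [0..<t] @ concat (map (\<lambda>k. replicate (2 ^ k - 1) k) [0..<t])"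

text \<open>The paths use these first blocks, one for each class; the copies behind them stay
  isolated in the subdivision and serve the count of degrees.\<close>

lemma class_list_nth: "q < t \<Longrightarrow> class_list t ! q = q"
  by (simp add: class_list_def nth_append)

lemma length_class_list_ge: "t \<le> length (class_list t)"
  by (simp add: class_list_def)

lemma class_list_less: "q < length (class_list t) \<Longrightarrow> class_list t ! q < t"
  using nth_mem[of q "class_list t"] by (auto simp: class_list_def simp del: nth_mem)

text \<open>\<open>set_encode\<close> is the sum of 2^k over a set, and each \<open>k\<close> occurs
  1 + (2^k - 1) times in the list. Injectivity of \<open>set_encode\<close> will recover the set
  from the count.\<close>

lemma card_class_list:
  "card {q. q < length (class_list t) \<and> P (class_list t ! q)} = set_encode {k. k < t \<and> P k}"
proof -
  have "length (filter P (class_list t)) = set_encode {k. k < t \<and> P k}"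
  proof (induction t)
    case (Suc t)
    have "{k. k < Suc t \<and> P k} = (if P t then insert t {k. k < t \<and> P k} else {k. k < t \<and> P k})"
      by (auto simp: less_Suc_eq)
    with Suc show ?case by (auto simp: class_list_def)
  qed (simp add: class_list_def)
  then show ?thesis by (simp add: length_filter_conv_card)
qed

section \<open>Degrees after flipping\<close>

context path_graph
begin

definition degree :: "(nat \<Rightarrow> nat \<Rightarrow> bool) \<Rightarrow> vertex \<Rightarrow> nat" where
  "degree F x = card {y \<in> vset Q m. flip_adj F t n E x y}"

lemma flip_adj_iff:
  assumes "x \<in> vset Q m" "y \<in> vset Q m"
  shows "flip_adj F t n E x y \<longleftrightarrow> x \<noteq> y \<and> F (fst x) (fst y) \<noteq> near x y"
  using assms by (auto simp: flip_adj_def near_def)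

lemma near_irrefl: "\<not> near x x"
  by (cases x) (auto simp: near_def)

lemma near_iff_flip_adj:
  assumes "x \<in> vset Q m" "y \<in> vset Q m"
  shows "near x y \<longleftrightarrow> x \<noteq> y \<and> F (fst x) (fst y) \<noteq> flip_adj F t n E x y"
  using flip_adj_iff[OF assms] near_irrefl[of x] by (cases "x = y") auto

lemma card_block_degree: "card {y \<in> vset Q m. F (fst y)} = m\<^sup>2 * card {q. q < Q \<and> F q}"
proof -
  have "{y \<in> vset Q m. F (fst y)} = {q. q < Q \<and> F q} \<times> {..<m} \<times> {..<m}"
    by (auto simp: vset_def)
  then show ?thesis by (simp add: power2_eq_square card_cartesian_product)
qed

text \<open>The pairs switched by \<open>near\<close> account for the error \<open>m\<close>. The
  additional 1 is \<open>x\<close> itself, which the block count includes if its class is joined to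
  itself by default.\<close>

lemma degree_bounds:
  fixes F :: "nat \<Rightarrow> nat \<Rightarrow> bool"
  assumes "x \<in> vset Q m"
  defines "w \<equiv> m\<^sup>2 * card {q. q < Q \<and> F (fst x) q}"
  shows "degree F x \<le> w + m" "w \<le> degree F x + m + 1"
proof -
  let ?A = "{y \<in> vset Q m. flip_adj F t n E x y}" and ?B = "{y \<in> vset Q m. F (fst x) (fst y)}"
  have w: "w = card ?B" unfolding w_def using card_block_degree[of "F (fst x)"] by simp
  have fin: "finite ?A" "finite ?B" "finite (nbrs x)" using finite_vset finite_nbrs by auto
  have "card ?A \<le> card (?B \<union> nbrs x)"
    using fin flip_adj_iff[OF assms(1)] by (intro card_mono) (auto simp: nbrs_def)
  also have "\<dots> \<le> card ?B + m"
    using card_Un_le[of ?B "nbrs x"] card_nbrs_le[of x] by linarith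
  finally show "degree F x \<le> w + m" unfolding degree_def w .
  have "card ?B \<le> card (insert x (?A \<union> nbrs x))"
    using fin flip_adj_iff[OF assms(1)] by (intro card_mono) (auto simp: nbrs_def)
  also have "\<dots> \<le> card ?A + m + 1"
    using card_Un_le[of ?A "nbrs x"] card_nbrs_le[of x] fin by (simp add: card_insert_if)
  finally show "w \<le> degree F x + m + 1" unfolding degree_def w .
qed

end

section \<open>Isomorphisms of the inputs lift to the constructed graphs\<close>

text \<open>A merged end is a sorted pair and \<open>\<pi>\<close> may reverse its order, hence the
  swap. Unsorted pairs of adjacent vertices lie on no path, but are swapped too so that the map
  stays bijective. Block 0 keeps its last coordinate: its path vertices are those with a 0 there,
  which \<open>\<pi>\<close> need not fix.\<close>

definition relabel :: "nat \<Rightarrow> (nat \<Rightarrow> nat \<Rightarrow> bool) \<Rightarrow> (nat \<Rightarrow> nat) \<Rightarrow> vertex \<Rightarrow> vertex" where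
  "relabel t E \<pi> = (\<lambda>(k, u, v).
     if t \<le> k then (k, u, v)
     else if k = 0 then (k, \<pi> u, v)
     else if k + 1 = t \<and> E u v \<and> (u < v) \<noteq> (\<pi> u < \<pi> v) then (k, \<pi> v, \<pi> u)
     else (k, \<pi> u, \<pi> v))"

lemma fst_relabel [simp]: "fst (relabel t E \<pi> x) = fst x"
  by (cases x) (simp add: relabel_def)

text \<open>\<open>\<pi>\<close> is the identity from \<open>n\<close> on because paths also lead
  towards numbers between \<open>n\<close> and \<open>m\<close>, which are not vertices of the
  input.\<close>

locale path_graph_iso =
  G: path_graph t n m Q E + H: path_graph t n m Q E'
  for t n m Q :: nat and E E' :: "nat \<Rightarrow> nat \<Rightarrow> bool" +
  fixes \<pi> \<pi>' :: "nat \<Rightarrow> nat"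
  assumes \<pi>_less: "u < n \<Longrightarrow> \<pi> u < n" and \<pi>_ge: "n \<le> u \<Longrightarrow> \<pi> u = u"
    and \<pi>'_\<pi>: "\<pi>' (\<pi> u) = u" and edge: "E' (\<pi> u) (\<pi> v) \<longleftrightarrow> E u v"
begin

lemma \<pi>_eq_iff: "\<pi> u = \<pi> v \<longleftrightarrow> u = v"
  using \<pi>'_\<pi> by metis

lemma \<pi>_less_m: "u < m \<Longrightarrow> \<pi> u < m"
  using \<pi>_less[of u] \<pi>_ge[of u] G.m by (cases "u < n") auto

lemma relabel_in_vset: "x \<in> vset Q m \<Longrightarrow> relabel t E \<pi> x \<in> vset Q m"
  by (cases x) (simp add: vset_def relabel_def \<pi>_less_m)

lemma relabel_inverse: "relabel t E' \<pi>' (relabel t E \<pi> x) = x"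
proof (cases x)
  case (fields k u v)
  show ?thesis
  proof (cases "0 < k \<and> k + 1 = t \<and> E u v")
    case True
    then have e: "E' (\<pi> u) (\<pi> v)" "E' (\<pi> v) (\<pi> u)" and ne: "u \<noteq> v"
      using edge G.E_sym G.E_irrefl by blast+
    then have "v < u \<longleftrightarrow> \<not> u < v" "\<pi> v < \<pi> u \<longleftrightarrow> \<not> \<pi> u < \<pi> v"
      using \<pi>_eq_iff[of u v] by auto
    then show ?thesis
      using fields True e by (cases "(u < v) = (\<pi> u < \<pi> v)") (simp_all add: relabel_def \<pi>'_\<pi>)
  next
    case False
    then show ?thesis
      using fields edge[of u v] by (cases "k = 0"; cases "t \<le> k") (auto simp: relabel_def \<pi>'_\<pi>)
  qed
qed

lemma relabel_chain:
  assumes "k < t"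
  shows "relabel t E \<pi> (chain t E k u v) = chain t E' k (\<pi> u) (\<pi> v)"
proof -
  have "E' (\<pi> v) (\<pi> u) \<longleftrightarrow> E u v" "E v u \<longleftrightarrow> E u v" using edge G.E_sym by blast+
  moreover have "u \<noteq> v" if "E u v" using that G.E_irrefl by blast
  ultimately show ?thesis
    using assms edge \<pi>_eq_iff[of u v] by (auto simp: relabel_def chain_def sorted_edge_def)
qed

lemma link_relabel:
  assumes "link t n E x y"
  shows "link t n E' (relabel t E \<pi> x) (relabel t E \<pi> y)"
proof -
  obtain k u v where k: "k + 1 < t" "u < n" "x = chain t E k u v" "y = chain t E (k + 1) u v"
    using assms unfolding G.link_iff by blast
  then show ?thesis unfolding H.link_iff
    by (intro exI[of _ k] exI[of _ "\<pi> u"] exI[of _ "\<pi> v"]) (auto simp: relabel_chain \<pi>_less)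
qed

end

locale path_graph_pair =
  G: path_graph t n m Q E + H: path_graph t n m Q E'
  for t n m Q :: nat and E E' :: "nat \<Rightarrow> nat \<Rightarrow> bool"
begin

text \<open>\<open>relabel\<close> never changes the block, so the default adjacency is preserved
  whatever \<open>F\<close> is, and only \<open>link\<close> has to be checked.\<close>

lemma flip_iso_if_iso:
  assumes p: "bij_betw p {..<n} {..<n}" and edge: "\<And>u v. u < n \<Longrightarrow> v < n \<Longrightarrow> E u v \<longleftrightarrow> E' (p u) (p v)"
  shows "\<exists>f. bij_betw f (vset Q m) (vset Q m) \<and>
    (\<forall>x\<in>vset Q m. \<forall>y\<in>vset Q m. flip_adj F t n E x y \<longleftrightarrow> flip_adj F t n E' (f x) (f y))"
proof -
  define \<pi> where "\<pi> u = (if u < n then p u else u)" for u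
  define \<pi>' where "\<pi>' u = (if u < n then inv_into {..<n} p u else u)" for u
  have lt: "\<pi> u < n" "\<pi>' u < n" if "u < n" for u
    using that bij_betwE[OF p] bij_betwE[OF bij_betw_inv_into[OF p]] by (auto simp: \<pi>_def \<pi>'_def)
  have ge: "\<pi> u = u" "\<pi>' u = u" if "n \<le> u" for u using that by (auto simp: \<pi>_def \<pi>'_def)
  have inv: "\<pi>' (\<pi> u) = u" "\<pi> (\<pi>' u) = u" for u
    using lt[of u] bij_betw_inv_into_left[OF p, of u] bij_betw_inv_into_right[OF p, of u]
    by (auto simp: \<pi>_def \<pi>'_def)
  have e1: "E' (\<pi> u) (\<pi> v) \<longleftrightarrow> E u v" for u v
  proof (cases "u < n \<and> v < n")
    case True
    then show ?thesis using edge by (simp add: \<pi>_def)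
  next
    case False
    moreover from this have "\<not> (\<pi> u < n \<and> \<pi> v < n)" using ge by (metis leI)
    ultimately show ?thesis using G.E_less G.E_less' H.E_less H.E_less' by blast
  qed
  have e2: "E (\<pi>' u) (\<pi>' v) \<longleftrightarrow> E' u v" for u v using e1[of "\<pi>' u" "\<pi>' v"] inv by simp
  interpret I: path_graph_iso t n m Q E E' \<pi> \<pi>'
    by unfold_locales (use lt ge inv e1 in auto)
  interpret J: path_graph_iso t n m Q E' E \<pi>' \<pi>
    by unfold_locales (use lt ge inv e2 in auto)
  let ?f = "relabel t E \<pi>"
  have "bij_betw ?f (vset Q m) (vset Q m)"
    by (rule bij_betw_byWitness[of _ "relabel t E' \<pi>'"])
       (use I.relabel_inverse J.relabel_inverse I.relabel_in_vset J.relabel_in_vset in auto)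
  moreover have "link t n E' (?f x) (?f y) \<longleftrightarrow> link t n E x y" for x y
    using I.link_relabel[of x y] J.link_relabel[of "?f x" "?f y"] I.relabel_inverse by auto
  moreover have "?f x = ?f y \<longleftrightarrow> x = y" for x y using I.relabel_inverse by metis
  ultimately show ?thesis by (intro exI[of _ ?f]) (auto simp: flip_adj_def)
qed

section \<open>Isomorphisms of the subdivisions descend to the inputs\<close>

lemma iso_if_near_iso:
  assumes f: "bij_betw f (vset Q m) (vset Q m)"
    and near: "\<And>x y. x \<in> vset Q m \<Longrightarrow> y \<in> vset Q m \<Longrightarrow> G.near x y \<longleftrightarrow> H.near (f x) (f y)"
  shows "\<exists>p. bij_betw p {..<n} {..<n} \<and> (\<forall>u<n. \<forall>v<n. E u v \<longleftrightarrow> E' (p u) (p v))"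
proof -
  let ?V = "vset Q m"
  have nbrs: "H.nbrs (f x) = f ` G.nbrs x" if x: "x \<in> ?V" for x
  proof (intro equalityI subsetI)
    fix z assume z: "z \<in> H.nbrs (f x)"
    then obtain y where "y \<in> ?V" "z = f y"
      using f H.nbrs_subset unfolding bij_betw_def by blast
    with z x near show "z \<in> f ` G.nbrs x" by (auto simp: G.nbrs_def H.nbrs_def)
  next
    fix z assume "z \<in> f ` G.nbrs x"
    then obtain y where y: "y \<in> G.nbrs x" "z = f y" by blast
    then have "y \<in> ?V" using G.nbrs_subset by blast
    with x y near show "z \<in> H.nbrs (f x)" by (simp add: G.nbrs_def H.nbrs_def)
  qed
  have "card (H.nbrs (f x)) = card (G.nbrs x)" if "x \<in> ?V" for x
    unfolding nbrs[OF that]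
    by (rule card_image) (rule inj_on_subset[OF bij_betw_imp_inj_on[OF f] G.nbrs_subset])
  then have origin: "(\<exists>u<n. f x = (0, u, 0)) \<longleftrightarrow> (\<exists>u<n. x = (0, u, 0))" if "x \<in> ?V" for x
    using that G.origin_iff_card_nbrs[of x] H.origin_iff_card_nbrs[of "f x"] by simp
  \<comment> \<open>By \<open>origin\<close>, \<open>f\<close> maps each (0, u, 0) with u < n to a
    vertex of the same form, from which the image of u is read off.\<close>
  define p where "p u = fst (snd (f (0, u, 0)))" for u
  have V: "(0, u, 0) \<in> ?V" if "u < n" for u using that G.t G.m by (auto simp: vset_def)
  have p: "f (0, u, 0) = (0, p u, 0)" "p u < n" if u: "u < n" for u
    using origin[OF V[OF u]] u by (auto simp: p_def)
  have inj: "inj_on p {..<n}"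
  proof (rule inj_onI)
    fix u v assume uv: "u \<in> {..<n}" "v \<in> {..<n}" "p u = p v"
    then have "f (0, u, 0) = f (0, v, 0)" using p by simp
    then show "u = v" using f V uv unfolding bij_betw_def inj_on_def by blast
  qed
  then have bij: "bij_betw p {..<n} {..<n}"
    using p(2) by (intro bij_betw_imageI inj endo_inj_surj) auto
  have walk1: "(f x, f y) \<in> {(x, y). H.near x y} ^^ d"
    if "(x, y) \<in> {(x, y). G.near x y} ^^ d" for x y d
    using that
  proof (induction d arbitrary: y)
    case (Suc d)
    then obtain z where z: "(x, z) \<in> {(x, y). G.near x y} ^^ d" "G.near z y" by auto
    moreover have "H.near (f z) (f y)" using z(2) near unfolding G.near_def by blast
    ultimately show ?case using Suc.IH[OF z(1)] by auto
  qed auto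
  \<comment> \<open>Walks lift back step by step: each next vertex has a preimage, because
    \<open>f\<close> is onto.\<close>
  have walk2: "\<exists>y\<in>?V. z = f y \<and> (x, y) \<in> {(x, y). G.near x y} ^^ d"
    if "(f x, z) \<in> {(x, y). H.near x y} ^^ d" "x \<in> ?V" for x z d
    using that
  proof (induction d arbitrary: z)
    case (Suc d)
    then obtain z' where z': "(f x, z') \<in> {(x, y). H.near x y} ^^ d" "H.near z' z" by auto
    from Suc.IH[OF z'(1) Suc.prems(2)] obtain y' where
      y': "y' \<in> ?V" "z' = f y'" "(x, y') \<in> {(x, y). G.near x y} ^^ d" by blast
    moreover obtain y where y: "y \<in> ?V" "z = f y"
      using z'(2) f unfolding H.near_def bij_betw_def by blast
    moreover have "G.near y' y" using z'(2) y' y near by simp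
    ultimately show ?case by auto
  qed auto
  have "E u v \<longleftrightarrow> E' (p u) (p v)" if uv: "u < n" "v < n" for u v
  proof (cases "u = v")
    case True
    then show ?thesis using G.E_irrefl H.E_irrefl by simp
  next
    case False
    then have ne: "p u \<noteq> p v" using inj uv unfolding inj_on_def by blast
    let ?d = "2 * (t - 1)"
    have "((0, u, 0), (0, v, 0)) \<in> {(x, y). G.near x y} ^^ ?d \<longleftrightarrow>
        (f (0, u, 0), f (0, v, 0)) \<in> {(x, y). H.near x y} ^^ ?d"
    proof
      assume "(f (0, u, 0), f (0, v, 0)) \<in> {(x, y). H.near x y} ^^ ?d"
      from walk2[OF this V[OF uv(1)]] obtain y where
        y: "y \<in> ?V" "f (0, v, 0) = f y" "((0, u, 0), y) \<in> {(x, y). G.near x y} ^^ ?d" by blast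
      then have "y = (0, v, 0)" using f V[OF uv(2)] unfolding bij_betw_def inj_on_def by blast
      with y show "((0, u, 0), (0, v, 0)) \<in> {(x, y). G.near x y} ^^ ?d" by simp
    qed (rule walk1)
    then show ?thesis
      using G.edge_iff_walk[OF uv(1) False] H.edge_iff_walk[OF p(2)[OF uv(1)] ne] p(1) uv by simp
  qed
  with bij show ?thesis by blast
qed

end

section \<open>Cancelling the flips\<close>

text \<open>Both multiples lie in the same window of length 2 m + 1 around \<open>d\<close>, which
  is shorter than the distance m^2 of distinct multiples.\<close>

lemma square_multiple_unique:
  fixes m w w' d :: nat
  assumes "3 \<le> m" "d \<le> m\<^sup>2 * w + m" "m\<^sup>2 * w \<le> d + m + 1" "d \<le> m\<^sup>2 * w' + m" "m\<^sup>2 * w' \<le> d + m + 1"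
  shows "w = w'"
proof -
  have m2: "2 * m + 1 < m\<^sup>2"
    using mult_right_mono[OF assms(1), of m] assms(1) unfolding power2_eq_square by linarith
  have "\<not> a < b" if "m\<^sup>2 * b \<le> m\<^sup>2 * a + (2 * m + 1)" for a b
  proof
    assume "a < b"
    then have "m\<^sup>2 * Suc a \<le> m\<^sup>2 * b" by (intro mult_left_mono) auto
    with that m2 show False by simp
  qed
  from this[of w' w] this[of w w'] show ?thesis using assms by (simp add: not_less)
qed

locale flip_graph_pair = path_graph_pair t n m "length (class_list t)" E E'
  for t n m :: nat and E E' :: "nat \<Rightarrow> nat \<Rightarrow> bool" +
  fixes La :: "nat \<Rightarrow> nat \<Rightarrow> bool"
  assumes La_sym: "k < t \<Longrightarrow> l < t \<Longrightarrow> La k l \<longleftrightarrow> La l k"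
begin

abbreviation "Q \<equiv> length (class_list t)"
abbreviation "cl q \<equiv> class_list t ! q"
abbreviation "F \<equiv> \<lambda>q q'. La (cl q) (cl q')"

lemma near_iso_if_flip_iso:
  assumes f: "bij_betw f (vset Q m) (vset Q m)"
    and adj: "\<And>x y. x \<in> vset Q m \<Longrightarrow> y \<in> vset Q m \<Longrightarrow>
      flip_adj F t n E x y \<longleftrightarrow> flip_adj F t n E' (f x) (f y)"
    and x: "x \<in> vset Q m" and y: "y \<in> vset Q m"
  shows "G.near x y \<longleftrightarrow> H.near (f x) (f y)"
proof -
  let ?V = "vset Q m"
  have fV: "f x \<in> ?V" if "x \<in> ?V" for x using f that by (auto simp: bij_betw_def)
  have cl: "cl (fst x) < t" if "x \<in> ?V" for x
    using that class_list_less by (auto simp: vset_def)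
  have row: "La (cl (fst x)) k \<longleftrightarrow> La (cl (fst (f x))) k" if x: "x \<in> ?V" and "k < t" for x k
  proof -
    have img: "f ` {y \<in> ?V. flip_adj F t n E x y} = {y \<in> ?V. flip_adj F t n E' (f x) y}"
    proof (intro equalityI subsetI)
      fix z assume z: "z \<in> {y \<in> ?V. flip_adj F t n E' (f x) y}"
      then obtain y where "y \<in> ?V" "z = f y" using f unfolding bij_betw_def by blast
      with z adj x show "z \<in> f ` {y \<in> ?V. flip_adj F t n E x y}" by auto
    next
      fix z assume "z \<in> f ` {y \<in> ?V. flip_adj F t n E x y}"
      then obtain y where "y \<in> ?V" "flip_adj F t n E x y" "z = f y" by blast
      with adj[OF x] fV show "z \<in> {y \<in> ?V. flip_adj F t n E' (f x) y}" by simp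
    qed
    have deg: "H.degree F (f x) = G.degree F x"
      unfolding H.degree_def G.degree_def img[symmetric]
      by (rule card_image, rule inj_on_subset[OF bij_betw_imp_inj_on[OF f]]) blast
    have "card {q. q < Q \<and> F (fst x) q} = card {q. q < Q \<and> F (fst (f x)) q}"
      by (rule square_multiple_unique[OF G.m(2) G.degree_bounds[OF x, of F]
          H.degree_bounds[OF fV[OF x], of F, unfolded deg]])
    then have "set_encode {k. k < t \<and> La (cl (fst x)) k} = set_encode {k. k < t \<and> La (cl (fst (f x))) k}"
      by (simp only: card_class_list)
    then have "{k. k < t \<and> La (cl (fst x)) k} = {k. k < t \<and> La (cl (fst (f x))) k}"
      by (simp add: set_encode_eq)
    with that show ?thesis by blast
  qed
  \<comment> \<open>\<open>row\<close> replaces a vertex by its image in the first argument only;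
    symmetry of \<open>La\<close> brings the second vertex to the front for its turn.\<close>
  have "F (fst x) (fst y) \<longleftrightarrow> F (fst (f x)) (fst y)" using row[OF x cl[OF y]] .
  also have "\<dots> \<longleftrightarrow> F (fst y) (fst (f x))" by (rule La_sym[OF cl[OF fV[OF x]] cl[OF y]])
  also have "\<dots> \<longleftrightarrow> F (fst (f y)) (fst (f x))" using row[OF y cl[OF fV[OF x]]] .
  also have "\<dots> \<longleftrightarrow> F (fst (f x)) (fst (f y))" by (rule La_sym[OF cl[OF fV[OF y]] cl[OF fV[OF x]]])
  finally have "F (fst x) (fst y) \<longleftrightarrow> F (fst (f x)) (fst (f y))" .
  moreover have "f x = f y \<longleftrightarrow> x = y" using f x y unfolding bij_betw_def inj_on_def by blast
  ultimately show ?thesis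
    using G.near_iff_flip_adj[OF x y, of F] H.near_iff_flip_adj[OF fV[OF x] fV[OF y], of F] adj[OF x y]
    by simp
qed

lemma flip_iso_iff_iso:
  "(\<exists>f. bij_betw f (vset Q m) (vset Q m) \<and>
     (\<forall>x\<in>vset Q m. \<forall>y\<in>vset Q m. flip_adj F t n E x y \<longleftrightarrow> flip_adj F t n E' (f x) (f y))) \<longleftrightarrow>
   (\<exists>p. bij_betw p {..<n} {..<n} \<and> (\<forall>u<n. \<forall>v<n. E u v \<longleftrightarrow> E' (p u) (p v)))"
proof
  assume "\<exists>f. bij_betw f (vset Q m) (vset Q m) \<and>
     (\<forall>x\<in>vset Q m. \<forall>y\<in>vset Q m. flip_adj F t n E x y \<longleftrightarrow> flip_adj F t n E' (f x) (f y))"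
  then obtain f where f: "bij_betw f (vset Q m) (vset Q m)"
    "\<And>x y. x \<in> vset Q m \<Longrightarrow> y \<in> vset Q m \<Longrightarrow> flip_adj F t n E x y \<longleftrightarrow> flip_adj F t n E' (f x) (f y)"
    by blast
  show "\<exists>p. bij_betw p {..<n} {..<n} \<and> (\<forall>u<n. \<forall>v<n. E u v \<longleftrightarrow> E' (p u) (p v))"
    by (rule iso_if_near_iso[OF f(1)]) (rule near_iso_if_flip_iso[OF f])
next
  assume "\<exists>p. bij_betw p {..<n} {..<n} \<and> (\<forall>u<n. \<forall>v<n. E u v \<longleftrightarrow> E' (p u) (p v))"
  then show "\<exists>f. bij_betw f (vset Q m) (vset Q m) \<and>
     (\<forall>x\<in>vset Q m. \<forall>y\<in>vset Q m. flip_adj F t n E x y \<longleftrightarrow> flip_adj F t n E' (f x) (f y))"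
    using flip_iso_if_iso by blast
qed

end


section \<open>Isomorphism-completeness\<close>

text \<open>A digraph isomorphism carries its own map on arcs and new tail and head functions.
  Comparing the components of \<open>H = app_iso h G\<close> shows the latter to be the projections,
  and then the arc map is forced to act by the vertex map on both ends.\<close>

lemma digraph_iso_iff:
  assumes "pair_graph G" "pair_graph H"
  shows "digraph_iso (with_proj G) (with_proj H) \<longleftrightarrow>
    (\<exists>f. bij_betw f (pverts G) (pverts H) \<and>
       (\<forall>u\<in>pverts G. \<forall>v\<in>pverts G. (u, v) \<in> parcs G \<longleftrightarrow> (f u, f v) \<in> parcs H))"
proof
  interpret G: pair_graph G by fact
  assume "digraph_iso (with_proj G) (with_proj H)"
  then obtain h where h: "G.digraph_isomorphism h" and H: "with_proj H = app_iso h (with_proj G)"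
    unfolding digraph_iso_def by blast
  let ?f = "iso_verts h"
  have verts: "pverts H = ?f ` pverts G" and arcs: "parcs H = iso_arcs h ` parcs G"
    and tl: "iso_tail h = fst" and hd: "iso_head h = snd"
    using arg_cong[OF H, of verts] arg_cong[OF H, of pre_digraph.arcs]
      arg_cong[OF H, of tail] arg_cong[OF H, of head] by simp_all
  have inj: "inj_on ?f (pverts G)" using h by (auto simp: G.digraph_isomorphism_def)
  have arc: "iso_arcs h (u, v) = (?f u, ?f v)" if "(u, v) \<in> parcs G" for u v
    using h that tl hd by (auto simp: G.digraph_isomorphism_def prod_eq_iff)
  have "(u, v) \<in> parcs G \<longleftrightarrow> (?f u, ?f v) \<in> parcs H" if uv: "u \<in> pverts G" "v \<in> pverts G" for u v
  proof
    assume "(u, v) \<in> parcs G"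
    then show "(?f u, ?f v) \<in> parcs H" unfolding arcs using arc by force
  next
    assume "(?f u, ?f v) \<in> parcs H"
    then obtain a b where "(a, b) \<in> parcs G" "(?f u, ?f v) = (?f a, ?f b)"
      unfolding arcs using arc by force
    moreover from this have "a \<in> pverts G" "b \<in> pverts G" using G.wellformed' by auto
    ultimately show "(u, v) \<in> parcs G" using inj uv unfolding inj_on_def by auto
  qed
  then show "\<exists>f. bij_betw f (pverts G) (pverts H) \<and>
       (\<forall>u\<in>pverts G. \<forall>v\<in>pverts G. (u, v) \<in> parcs G \<longleftrightarrow> (f u, f v) \<in> parcs H)"
    using inj verts by (auto simp: bij_betw_def)
next
  interpret G: pair_graph G by fact
  interpret H: pair_graph H by fact
  assume "\<exists>f. bij_betw f (pverts G) (pverts H) \<and>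
       (\<forall>u\<in>pverts G. \<forall>v\<in>pverts G. (u, v) \<in> parcs G \<longleftrightarrow> (f u, f v) \<in> parcs H)"
  then obtain f where f: "inj_on f (pverts G)" "f ` pverts G = pverts H"
    and arc: "\<And>u v. u \<in> pverts G \<Longrightarrow> v \<in> pverts G \<Longrightarrow> (u, v) \<in> parcs G \<longleftrightarrow> (f u, f v) \<in> parcs H"
    unfolding bij_betw_def by blast
  let ?h = "\<lparr>iso_verts = f, iso_arcs = map_prod f f, iso_head = snd, iso_tail = fst\<rparr>"
  have sub: "parcs G \<subseteq> pverts G \<times> pverts G" using G.wellformed' by auto
  have "inj_on (map_prod f f) (parcs G)"
    using map_prod_inj_on[OF f(1) f(1)] sub inj_on_subset by blast
  then have "G.digraph_isomorphism ?h"
    using f(1) G.wf_digraph by (auto simp: G.digraph_isomorphism_def)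
  moreover have "parcs H = map_prod f f ` parcs G"
  proof (intro equalityI subsetI)
    fix e assume e: "e \<in> parcs H"
    then obtain u v where "e = (f u, f v)" "u \<in> pverts G" "v \<in> pverts G"
      using H.wellformed' f(2) by (metis imageE surj_pair)
    with e arc show "e \<in> map_prod f f ` parcs G" by force
  qed (use arc sub in auto)
  then have "with_proj H = app_iso ?h (with_proj G)"
    using f(2) by (auto simp: app_iso_def with_proj_def)
  ultimately show "digraph_iso (with_proj G) (with_proj H)"
    unfolding digraph_iso_def by blast
qed

section \<open>Graphs given by a list of vertices\<close>

text \<open>Positions in the list take over as vertices, because only graphs on an initial segment
  of the numbers are written as words.\<close>

definition numbered_graph :: "'a list \<Rightarrow> ('a \<Rightarrow> 'a \<Rightarrow> bool) \<Rightarrow> nat pair_pre_digraph" where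
  "numbered_graph V A = \<lparr>pverts = {..<length V},
     parcs = {(i, j). i < length V \<and> j < length V \<and> A (V ! i) (V ! j)}\<rparr>"

lemma pair_graph_numbered_graph:
  assumes "\<And>x. \<not> A x x" "\<And>x y. x \<in> set V \<Longrightarrow> y \<in> set V \<Longrightarrow> A x y \<Longrightarrow> A y x"
  shows "pair_graph (numbered_graph V A)"
proof
  have "parcs (numbered_graph V A) \<subseteq> {..<length V} \<times> {..<length V}"
    by (auto simp: numbered_graph_def)
  then show "finite (parcs (numbered_graph V A))" by (rule finite_subset) simp
  show "symmetric (with_proj (numbered_graph V A))"
    unfolding symmetric_def with_proj_simps by (rule symI) (use assms in \<open>auto simp: numbered_graph_def\<close>)
qed (use assms in \<open>auto simp: numbered_graph_def\<close>)

lemma std_graph_numbered_graph: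
  "pair_graph (numbered_graph V A) \<Longrightarrow> std_graph (numbered_graph V A)"
  by (simp add: std_graph_def numbered_graph_def)

lemma graph_code_numbered_graph:
  "graph_code (numbered_graph V A) =
     replicate (length V) True @ [False] @ concat (map (\<lambda>x. map (A x) V) V)"
proof -
  have nth: "map f V = map (\<lambda>i. f (V ! i)) [0..<length V]" for f :: "'a \<Rightarrow> 'c"
    by (rule nth_equalityI) auto
  show ?thesis
    unfolding graph_code_def Let_def numbered_graph_def nth
    by (auto intro!: arg_cong[where f = concat] simp: concat_map_singleton)
qed

text \<open>Conjugation with the bijections that index the lists. It allows the combinatorial
  argument to stay with triples.\<close>

lemma numbered_graph_iso_iff:
  assumes V: "distinct V" and W: "distinct W"
  shows "(\<exists>f. bij_betw f {..<length V} {..<length W} \<and>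
      (\<forall>i\<in>{..<length V}. \<forall>j\<in>{..<length V}. A (V ! i) (V ! j) \<longleftrightarrow> B (W ! f i) (W ! f j))) \<longleftrightarrow>
    (\<exists>g. bij_betw g (set V) (set W) \<and> (\<forall>x\<in>set V. \<forall>y\<in>set V. A x y \<longleftrightarrow> B (g x) (g y)))"
    (is "?L \<longleftrightarrow> ?R")
proof -
  have v: "bij_betw ((!) V) {..<length V} (set V)" and w: "bij_betw ((!) W) {..<length W} (set W)"
    using V W by (auto intro: bij_betw_nth)
  let ?v = "inv_into {..<length V} ((!) V)" and ?w = "inv_into {..<length W} ((!) W)"
  note vi = bij_betw_inv_into[OF v] and wi = bij_betw_inv_into[OF w]
  have vv: "?v x \<in> {..<length V}" "V ! ?v x = x" if "x \<in> set V" for x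
    using that vi bij_betw_inv_into_right[OF v] by (auto simp: bij_betw_def)
  have ww: "W ! ?w x = x" if "x \<in> set W" for x
    using that bij_betw_inv_into_right[OF w] by auto
  show ?thesis
  proof
    assume ?L
    then obtain f where f: "bij_betw f {..<length V} {..<length W}"
      "\<And>i j. i < length V \<Longrightarrow> j < length V \<Longrightarrow> A (V ! i) (V ! j) \<longleftrightarrow> B (W ! f i) (W ! f j)" by blast
    have "bij_betw ((!) W \<circ> (f \<circ> ?v)) (set V) (set W)"
      by (intro bij_betw_trans[OF _ w] bij_betw_trans[OF vi f(1)])
    moreover have "A x y \<longleftrightarrow> B (W ! f (?v x)) (W ! f (?v y))" if "x \<in> set V" "y \<in> set V" for x y
      using f(2)[of "?v x" "?v y"] vv that by auto
    ultimately show ?R by (intro exI[of _ "(!) W \<circ> (f \<circ> ?v)"]) auto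
  next
    assume ?R
    then obtain g where g: "bij_betw g (set V) (set W)"
      "\<And>x y. x \<in> set V \<Longrightarrow> y \<in> set V \<Longrightarrow> A x y \<longleftrightarrow> B (g x) (g y)" by blast
    have "bij_betw (?w \<circ> (g \<circ> (!) V)) {..<length V} {..<length W}"
      by (intro bij_betw_trans[OF _ wi] bij_betw_trans[OF v g(1)])
    moreover have "W ! ?w (g (V ! i)) = g (V ! i)" if "i < length V" for i
      using ww bij_betwE[OF g(1)] nth_mem[OF that] by blast
    ultimately show ?L using g(2) by (intro exI[of _ "?w \<circ> (g \<circ> (!) V)"]) auto
  qed
qed

lemma vertices_eq_product: "vertices Q m = List.product [0..<Q] (List.product [0..<m] [0..<m])"
  by (simp add: vertices_def product_concat_map map_concat comp_def)

lemma distinct_vertices: "distinct (vertices Q m)"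
  unfolding vertices_eq_product by (intro distinct_product) auto

section \<open>Reading a graph code back from memory\<close>

lemma length_concat_matrix: "length (concat (map (\<lambda>i. map (f i) [0..<n]) [0..<k])) = k * n"
  by (induction k) auto

lemma nth_concat_matrix:
  assumes "u < k" "v < n"
  shows "concat (map (\<lambda>i. map (f i) [0..<n]) [0..<k]) ! (v + u * n) = f u v"
  using assms(1)
proof (induction k)
  case (Suc k)
  show ?case
  proof (cases "u = k")
    case True
    then show ?thesis using assms(2) by (simp add: nth_append length_concat_matrix)
  next
    case False
    then have "u < k" using Suc.prems by simp
    then have "Suc u * n \<le> k * n" by (intro mult_right_mono) auto
    then have "v + u * n < k * n" using assms(2) by simp
    with Suc.IH[OF \<open>u < k\<close>] show ?thesis by (simp add: nth_append length_concat_matrix)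
  qed
qed simp

lemma graph_code_eq:
  "graph_code G = replicate (card (pverts G)) True @ [False] @
     concat (map (\<lambda>i. map (\<lambda>j. (i, j) \<in> parcs G) [0..<card (pverts G)]) [0..<card (pverts G)])"
  by (simp add: graph_code_def Let_def concat_map_singleton)

text \<open>The code may stand anywhere in the input, as it has to be read both in first and in
  second place.\<close>

lemma parse_graph_code:
  assumes G: "std_graph G" and x: "x = xs @ graph_code G @ ys"
  defines "\<mu> \<equiv> mem (ram_init x)" and "b \<equiv> length xs" and "n \<equiv> card (pverts G)"
  shows "ones \<mu> b = n" "matrix_at \<mu> (b + n + 1) n = (\<lambda>u v. (u, v) \<in> parcs G)"
proof -
  let ?M = "concat (map (\<lambda>i. map (\<lambda>j. (i, j) \<in> parcs G) [0..<n]) [0..<n])"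
  have x': "x = xs @ replicate n True @ [False] @ ?M @ ys"
    unfolding x graph_code_eq n_def by simp
  have \<mu>: "\<mu> i = (if i < length x \<and> x ! i then 1 else 0)" for i
    by (simp add: \<mu>_def ram_init_def)
  show "ones \<mu> b = n" unfolding ones_def
  proof (rule Least_equality)
    show "\<mu> (b + n) = 0" unfolding \<mu> x' b_def by (simp add: nth_append)
    fix k assume k: "\<mu> (b + k) = 0"
    show "n \<le> k"
    proof (rule ccontr)
      assume "\<not> n \<le> k"
      then show False using k unfolding \<mu> x' b_def by (simp add: nth_append)
    qed
  qed
  interpret pair_graph G using G by (simp add: std_graph_def)
  have V: "pverts G = {..<n}" using G by (simp add: std_graph_def n_def)
  have "matrix_at \<mu> (b + n + 1) n u v \<longleftrightarrow> (u, v) \<in> parcs G" for u v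
  proof (cases "u < n \<and> v < n")
    case True
    then have "Suc u * n \<le> n * n" by (intro mult_right_mono) auto
    then have lt: "v + u * n < n * n" using True by simp
    have "(x ! (b + n + 1 + v + u * n)) = ?M ! (v + u * n)"
      unfolding x' b_def using lt by (simp add: nth_append length_concat_matrix)
    moreover have "b + n + 1 + v + u * n < length x"
      unfolding x' b_def using lt by (simp add: length_concat_matrix)
    ultimately show ?thesis
      using True nth_concat_matrix[of u n v n "\<lambda>i j. (i, j) \<in> parcs G"]
      by (simp add: matrix_at_def \<mu>)
  next
    case False
    then show ?thesis using wellformed' V by (auto simp: matrix_at_def)
  qed
  then show "matrix_at \<mu> (b + n + 1) n = (\<lambda>u v. (u, v) \<in> parcs G)" by blast
qed

definition path_encoded ::
  "nat \<Rightarrow> (nat \<Rightarrow> nat \<Rightarrow> bool) \<Rightarrow> nat \<Rightarrow> nat pair_pre_digraph \<Rightarrow> nat pair_pre_digraph" where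
  "path_encoded Q F t G = (let n = card (pverts G) in
     numbered_graph (vertices Q (n + 3)) (flip_adj F t n (\<lambda>u v. (u, v) \<in> parcs G)))"

lemma word_at_graph_code:
  assumes "std_graph G" "x = xs @ graph_code G @ ys"
  shows "word_at Q F t (mem (ram_init x)) (length xs) = graph_code (path_encoded Q F t G)"
  unfolding word_at_def parse_graph_code[OF assms]
  by (simp add: word_def path_encoded_def graph_code_numbered_graph Let_def)

lemma reduction_graph_code:
  assumes "std_graph G" "std_graph H"
  shows "reduction Q F t (graph_code G @ graph_code H) =
    graph_code (path_encoded Q F t G) @ graph_code (path_encoded Q F t H)"
proof -
  let ?x = "graph_code G @ graph_code H" and ?n = "card (pverts G)"
  have n: "ones (mem (ram_init ?x)) 0 = ?n"
    using parse_graph_code(1)[OF assms(1), of ?x "[]" "graph_code H"] by simp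
  have len: "length (graph_code G) = ?n + 1 + ?n * ?n"
    by (simp add: graph_code_eq length_concat_matrix)
  have "word_at Q F t (mem (ram_init ?x)) 0 = graph_code (path_encoded Q F t G)"
    using word_at_graph_code[OF assms(1), of ?x "[]" "graph_code H"] by simp
  moreover have "word_at Q F t (mem (ram_init ?x)) (?n + 1 + ?n * ?n) = graph_code (path_encoded Q F t H)"
    using word_at_graph_code[OF assms(2), of ?x "graph_code G" "[]"] unfolding len by simp
  ultimately show ?thesis by (simp add: reduction_def Let_def n)
qed

lemma path_graph_std_graph:
  assumes "std_graph G" "2 \<le> t" "t \<le> Q"
  shows "path_graph t (card (pverts G)) (card (pverts G) + 3) Q (\<lambda>u v. (u, v) \<in> parcs G)"
proof -
  interpret pair_graph G using assms by (simp add: std_graph_def)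
  have V: "pverts G = {..<card (pverts G)}" using assms by (simp add: std_graph_def)
  have "(v, u) \<in> parcs G" if "(u, v) \<in> parcs G" for u v
    using pair_sym_arcs that unfolding symmetric_def with_proj_simps by (rule symD)
  moreover have "(u, u) \<notin> parcs G" for u using pair_no_loops by force
  moreover have "u < card (pverts G)" if "(u, v) \<in> parcs G" for u v
    using in_arcsD1[OF that] V by auto
  ultimately show ?thesis using assms by unfold_locales auto
qed

lemma link_fst: "link t n E x y \<Longrightarrow> fst y = fst x + 1 \<and> fst y < t"
  by (cases x; cases y) simp

section \<open>Encoded graphs belong to the class\<close>

locale path_encoding =
  fixes J :: "'j set" and L :: "'j \<Rightarrow> 'j \<Rightarrow> label" and LN :: "'j \<Rightarrow> 'j \<Rightarrow> enat" and p :: "'j list"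
  assumes L_sym: "j \<in> J \<Longrightarrow> j' \<in> J \<Longrightarrow> L j j' = L j' j"
    and p: "2 \<le> length p" "distinct p" "set p \<subseteq> J"
    and LN_first: "LN (p ! 0) (p ! 1) = \<infinity>"
    and LN_last: "2 \<le> LN (p ! (length p - 1)) (p ! (length p - 2))"
    and LN_step: "k + 1 < length p \<Longrightarrow> 1 \<le> LN (p ! k) (p ! (k + 1))"
      "k + 1 < length p \<Longrightarrow> 1 \<le> LN (p ! (k + 1)) (p ! k)"
begin

abbreviation "t \<equiv> length p"
abbreviation "Q \<equiv> length (class_list t)"
abbreviation "cl q \<equiv> class_list t ! q"

definition La :: "nat \<Rightarrow> nat \<Rightarrow> bool" where
  "La k l \<longleftrightarrow> L (p ! k) (p ! l) = LabA"

abbreviation "F \<equiv> \<lambda>q q'. La (cl q) (cl q')"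
abbreviation "enc \<equiv> path_encoded Q F t"

lemma p_in_J: "k < t \<Longrightarrow> p ! k \<in> J"
  using p by auto

lemma La_sym: "k < t \<Longrightarrow> l < t \<Longrightarrow> La k l \<longleftrightarrow> La l k"
  using L_sym[OF p_in_J p_in_J] by (simp add: La_def)

text \<open>Symmetry of \<open>L\<close> makes the default adjacency symmetric, and links enter in
  both directions.\<close>

lemma pair_graph_enc:
  assumes "std_graph G"
  shows "pair_graph (enc G)"
  unfolding path_encoded_def Let_def
proof (rule pair_graph_numbered_graph)
  let ?n = "card (pverts G)" and ?E = "\<lambda>u v. (u, v) \<in> parcs G"
  fix x y assume "x \<in> set (vertices Q (?n + 3))" "y \<in> set (vertices Q (?n + 3))"
  then have "cl (fst x) < t" "cl (fst y) < t"
    using class_list_less by (auto simp: set_vertices vset_def)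
  then show "flip_adj F t ?n ?E x y \<Longrightarrow> flip_adj F t ?n ?E y x"
    using La_sym by (auto simp: flip_adj_def)
qed (simp add: flip_adj_def)

lemma std_graph_enc: "std_graph G \<Longrightarrow> std_graph (enc G)"
  using pair_graph_enc unfolding path_encoded_def Let_def by (intro std_graph_numbered_graph) auto

lemma enc_iso_iff:
  assumes G: "std_graph G" and H: "std_graph H"
  shows "digraph_iso (with_proj (enc G)) (with_proj (enc H)) \<longleftrightarrow>
    digraph_iso (with_proj G) (with_proj H)"
proof -
  let ?n = "card (pverts G)" and ?n' = "card (pverts H)"
  let ?E = "\<lambda>u v. (u, v) \<in> parcs G" and ?E' = "\<lambda>u v. (u, v) \<in> parcs H"
  let ?V = "vset Q (?n + 3)" and ?V' = "vset Q (?n' + 3)"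
  have Q: "t \<le> Q" by (rule length_class_list_ge)
  have "digraph_iso (with_proj (enc G)) (with_proj (enc H)) \<longleftrightarrow>
      (\<exists>f. bij_betw f ?V ?V' \<and>
        (\<forall>x\<in>?V. \<forall>y\<in>?V. flip_adj F t ?n ?E x y \<longleftrightarrow> flip_adj F t ?n' ?E' (f x) (f y)))"
    (is "_ \<longleftrightarrow> ?R")
  proof -
    let ?W = "vertices Q (?n + 3)" and ?W' = "vertices Q (?n' + 3)"
    have verts: "pverts (enc G) = {..<length ?W}" "pverts (enc H) = {..<length ?W'}"
      by (simp_all add: path_encoded_def numbered_graph_def Let_def)
    have arcs: "(i, j) \<in> parcs (enc G) \<longleftrightarrow>
        i < length ?W \<and> j < length ?W \<and> flip_adj F t ?n ?E (?W ! i) (?W ! j)"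
      "(i, j) \<in> parcs (enc H) \<longleftrightarrow>
        i < length ?W' \<and> j < length ?W' \<and> flip_adj F t ?n' ?E' (?W' ! i) (?W' ! j)" for i j
      by (simp_all add: path_encoded_def numbered_graph_def Let_def)
    have "digraph_iso (with_proj (enc G)) (with_proj (enc H)) \<longleftrightarrow>
      (\<exists>f. bij_betw f {..<length ?W} {..<length ?W'} \<and>
        (\<forall>i\<in>{..<length ?W}. \<forall>j\<in>{..<length ?W}.
          flip_adj F t ?n ?E (?W ! i) (?W ! j) \<longleftrightarrow> flip_adj F t ?n' ?E' (?W' ! f i) (?W' ! f j)))"
      unfolding digraph_iso_iff[OF pair_graph_enc[OF G] pair_graph_enc[OF H]] verts
      by (rule ex_cong1, rule conj_cong[OF refl], intro ball_cong refl)
         (auto simp: arcs dest!: bij_betwE)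
    then show ?thesis
      by (simp only: numbered_graph_iso_iff[OF distinct_vertices distinct_vertices] set_vertices)
  qed
  also have "?R \<longleftrightarrow> (\<exists>f. bij_betw f {..<?n} {..<?n'} \<and>
      (\<forall>u\<in>{..<?n}. \<forall>v\<in>{..<?n}. ?E u v \<longleftrightarrow> ?E' (f u) (f v)))" (is "_ \<longleftrightarrow> ?S")
  proof (cases "?n = ?n'")
    case True
    interpret P: flip_graph_pair t ?n "?n + 3" ?E ?E' La
      using path_graph_std_graph[OF G p(1) Q] path_graph_std_graph[OF H p(1) Q] La_sym True
      by (simp add: flip_graph_pair_def path_graph_pair_def flip_graph_pair_axioms_def)
    show ?thesis using P.flip_iso_iff_iso unfolding True[symmetric] by (simp add: Ball_def)
  next
    case False
    \<comment> \<open>Inputs of different size give constructions of different size, so both sides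
      fail.\<close>
    have "\<not> ?R"
    proof
      assume ?R
      then have "Q * (?n + 3)\<^sup>2 = Q * (?n' + 3)\<^sup>2"
        using bij_betw_same_card by (metis card_vset)
      moreover have "0 < Q" using Q p(1) by linarith
      ultimately have "(?n + 3)\<^sup>2 = (?n' + 3)\<^sup>2" by (metis mult_cancel1 less_not_refl)
      then have "?n + 3 = ?n' + 3" by (simp only: power2_eq_iff_nonneg)
      with False show False by simp
    qed
    moreover have "\<not> ?S" using False bij_betw_same_card by fastforce
    ultimately show ?thesis by blast
  qed
  also have "?S \<longleftrightarrow> digraph_iso (with_proj G) (with_proj H)"
    using G H digraph_iso_iff[of G H] by (simp add: std_graph_def)
  finally show ?thesis .
qed

text \<open>This is where every hypothesis on \<open>LN\<close> is spent. An original vertex has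
  many neighbours in the next class, but there \<open>LN\<close> is infinite and \<open>fin\<close>
  excludes the case. A merged end has up to two neighbours below it, covered by
  \<open>LN_last\<close>. Otherwise a path gives at most one neighbour in each direction, covered by
  \<open>LN_step\<close>.\<close>

lemma card_near_class_le:
  assumes "path_graph t n m Q E" and x: "x \<in> vset Q m" and fin: "LN (p ! cl (fst x)) j \<noteq> \<infinity>"
  shows "enat (card {y. path_graph.near t n m Q E x y \<and> p ! cl (fst y) = j}) \<le> LN (p ! cl (fst x)) j"
proof -
  interpret path_graph t n m Q E by fact
  let ?N = "{y. near x y \<and> p ! cl (fst y) = j}"
  show ?thesis
  proof (cases "?N = {}")
    case True
    then show ?thesis by (simp only: card.empty zero_enat_def[symmetric] zero_le)
  next
    case False
    obtain k a b where xk: "x = (k, a, b)" by (cases x) auto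
    have adj: "k < t \<and> fst y < t \<and> (fst y = k + 1 \<or> k = fst y + 1)" if "near x y" for y
    proof -
      from that have "link t n E x y \<or> link t n E y x" by (simp add: near_def)
      then show ?thesis using xk link_fst[of t n E x y] link_fst[of t n E y x] by auto
    qed
    from False obtain y0 where y0: "near x y0" "p ! cl (fst y0) = j" by blast
    define k' where "k' = fst y0"
    have k: "k < t" "k' < t" "k' = k + 1 \<or> k = k' + 1" using adj[OF y0(1)] by (auto simp: k'_def)
    have j: "j = p ! k'" using y0 k by (simp add: class_list_nth k'_def)
    \<comment> \<open>As \<open>p\<close> is distinct, \<open>j\<close> determines one of the first
      t blocks. So the neighbours counted all lie above \<open>x\<close> or all lie below
      it.\<close>
    have fst: "fst y = k'" if "near x y" "p ! cl (fst y) = j" for y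
      using that adj[OF that(1)] j k(2) nth_eq_iff_index_eq[OF p(2)] by (simp add: class_list_nth)
    have x_cl: "p ! cl (fst x) = p ! k" using xk k by (simp add: class_list_nth)
    from k(3) show ?thesis
    proof
      assume k': "k' = k + 1"
      have "k \<noteq> 0"
      proof
        assume "k = 0"
        then have "LN (p ! k) j = \<infinity>" using LN_first j k' by simp
        with fin x_cl show False by simp
      qed
      have "?N \<subseteq> {ch (k + 1) a b}"
      proof
        fix y assume y: "y \<in> ?N"
        then have "fst y = fst x + 1" using fst[of y] xk k' by simp
        with y have "link t n E x y" using link_fst[of t n E y x] by (auto simp: near_def)
        then show "y \<in> {ch (k + 1) a b}" using link_up[of k a b y] \<open>k \<noteq> 0\<close> xk by simp
      qed
      then have "card ?N \<le> 1" using card_mono[of "{ch (k + 1) a b}" ?N] by simp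
      then have "enat (card ?N) \<le> 1" by (simp add: one_enat_def)
      also have "1 \<le> LN (p ! k) (p ! (k + 1))" using LN_step(1) k k' by simp
      finally show ?thesis unfolding x_cl j k' .
    next
      assume k': "k = k' + 1"
      have sub: "?N \<subseteq> {ch (k - 1) a b, if k + 1 = t then ch (k - 1) b a else ch (k - 1) a b}"
      proof
        fix y assume y: "y \<in> ?N"
        then have "fst x = fst y + 1" using fst[of y] xk k' by simp
        with y have "link t n E y x" using link_fst[of t n E x y] by (auto simp: near_def)
        then show "y \<in> {ch (k - 1) a b, if k + 1 = t then ch (k - 1) b a else ch (k - 1) a b}"
          using link_down[of y k a b] xk by auto
      qed
      show ?thesis
      proof (cases "k + 1 = t")
        case True
        have "card ?N \<le> card {ch (k - 1) a b, ch (k - 1) b a}"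
          using sub True by (intro card_mono) auto
        also have "\<dots> \<le> 2" by (simp add: card_insert_if)
        finally have "enat (card ?N) \<le> 2" by (simp add: numeral_eq_enat)
        also have "2 \<le> LN (p ! k) (p ! k')"
        proof -
          have "length p - 1 = k" "length p - 2 = k'" using True k' by auto
          then show ?thesis using LN_last by simp
        qed
        finally show ?thesis unfolding x_cl j .
      next
        case False
        then have "card ?N \<le> 1" using sub card_mono[of "{ch (k - 1) a b}" ?N] by simp
        then have "enat (card ?N) \<le> 1" by (simp add: one_enat_def)
        also have "1 \<le> LN (p ! k) (p ! k')" using LN_step(2)[of k'] k k' by simp
        finally show ?thesis unfolding x_cl j .
      qed
    qed
  qed
qed

lemma encoded_by_enc:
  assumes G: "std_graph G"
  shows "encoded_by J L LN (enc G)"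
proof -
  let ?n = "card (pverts G)" and ?E = "\<lambda>u v. (u, v) \<in> parcs G"
  let ?V = "vertices Q (?n + 3)"
  have pg: "path_graph t ?n (?n + 3) Q ?E"
    by (rule path_graph_std_graph[OF G p(1) length_class_list_ge])
  interpret path_graph t ?n "?n + 3" Q ?E by (rule pg)
  have verts: "pverts (enc G) = {..<length ?V}"
    and arcs: "(i, j) \<in> parcs (enc G) \<longleftrightarrow> i < length ?V \<and> j < length ?V \<and> flip_adj F t ?n ?E (?V ! i) (?V ! j)"
    for i j by (auto simp: path_encoded_def numbered_graph_def Let_def)
  define \<phi> where "\<phi> i = p ! cl (fst (?V ! i))" for i
  have V: "?V ! i \<in> vset Q (?n + 3)" if "i < length ?V" for i
    using that nth_mem set_vertices by metis
  have cl: "cl (fst (?V ! i)) < t" if "i < length ?V" for i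
    using V[OF that] class_list_less by (auto simp: vset_def)
  \<comment> \<open>One count serves both labels: the exceptions are the pairs whose adjacency
    differs from the label, and the flip turns exactly these into pairs related by
    \<open>near\<close>.\<close>
  have bound: "enat (card {i' \<in> pverts (enc G). i' \<noteq> i \<and> \<phi> i' = j \<and>
      ((i, i') \<in> parcs (enc G)) \<noteq> (L (\<phi> i) j = LabA)}) \<le> LN (\<phi> i) j" (is "enat (card ?I) \<le> _")
    if i: "i < length ?V" and fin: "LN (\<phi> i) j \<noteq> \<infinity>" for i j
  proof -
    let ?N = "{y. near (?V ! i) y \<and> p ! cl (fst y) = j}"
    have "(!) ?V ` ?I \<subseteq> ?N"
    proof (intro image_subsetI)
      fix i' assume "i' \<in> ?I"
      then have i': "i' < length ?V" "i' \<noteq> i" "\<phi> i' = j"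
        and e: "flip_adj F t ?n ?E (?V ! i) (?V ! i') \<noteq> (L (\<phi> i) j = LabA)"
        using verts arcs i by auto
      have "?V ! i \<noteq> ?V ! i'" using i i' distinct_vertices nth_eq_iff_index_eq by blast
      then have "near (?V ! i) (?V ! i')"
        using e i'(3) flip_adj_iff[OF V[OF i] V[OF i'(1)], of F] by (auto simp: La_def \<phi>_def)
      with i'(3) show "?V ! i' \<in> ?N" by (simp add: \<phi>_def)
    qed
    moreover have "inj_on ((!) ?V) ?I"
      by (rule inj_on_nth[OF distinct_vertices]) (simp add: verts)
    moreover have "finite ?N"
      using finite_nbrs[of "?V ! i"] by (auto simp: nbrs_def intro: finite_subset)
    ultimately have "card ?I \<le> card ?N" by (intro card_inj_on_le)
    then have "enat (card ?I) \<le> enat (card ?N)" by simp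
    also have "\<dots> \<le> LN (\<phi> i) j"
      using card_near_class_le[OF pg V[OF i], of j] fin by (simp add: \<phi>_def)
    finally show ?thesis .
  qed
  show ?thesis unfolding encoded_by_def
  proof (intro bexI[of _ \<phi>] ballI conjI impI)
    show "\<phi> \<in> pverts (enc G) \<rightarrow> J" using cl p_in_J by (auto simp: verts \<phi>_def)
  next
    fix i j assume "i \<in> pverts (enc G)" "L (\<phi> i) j = LabA \<and> LN (\<phi> i) j \<noteq> \<infinity>"
    then show "enat (card {i' \<in> pverts (enc G). i' \<noteq> i \<and> \<phi> i' = j \<and> (i, i') \<notin> parcs (enc G)}) \<le> LN (\<phi> i) j"
      using bound[of i j] by (simp add: verts)
  next
    fix i j assume "i \<in> pverts (enc G)" "L (\<phi> i) j = LabN \<and> LN (\<phi> i) j \<noteq> \<infinity>"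
    then show "enat (card {i' \<in> pverts (enc G). i' \<noteq> i \<and> \<phi> i' = j \<and> (i, i') \<in> parcs (enc G)}) \<le> LN (\<phi> i) j"
      using bound[of i j] by (simp add: verts)
  qed
qed

lemma reducible: "poly_reducible (graph_iso_problem (\<lambda>_. True)) (graph_iso_problem (encoded_by J L LN))"
  unfolding poly_reducible_def
proof (intro exI[of _ "reduction Q F t"] conjI)
  show "poly_time_computable (reduction Q F t)" by (rule poly_time_computable_reduction)
  show "reduction Q F t ` yes_instances (graph_iso_problem (\<lambda>_. True)) \<subseteq>
      yes_instances (graph_iso_problem (encoded_by J L LN))"
  proof (rule image_subsetI)
    fix x assume "x \<in> yes_instances (graph_iso_problem (\<lambda>_. True))"
    then obtain G H where "std_graph G" "std_graph H" "x = graph_code G @ graph_code H"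
      "digraph_iso (with_proj G) (with_proj H)"
      unfolding graph_iso_problem_def by auto
    then show "reduction Q F t x \<in> yes_instances (graph_iso_problem (encoded_by J L LN))"
      unfolding graph_iso_problem_def promise_problem.simps mem_Collect_eq
      by (intro exI[of _ "enc G"] exI[of _ "enc H"])
         (simp add: reduction_graph_code std_graph_enc encoded_by_enc enc_iso_iff)
  qed
  show "reduction Q F t ` no_instances (graph_iso_problem (\<lambda>_. True)) \<subseteq>
      no_instances (graph_iso_problem (encoded_by J L LN))"
  proof (rule image_subsetI)
    fix x assume "x \<in> no_instances (graph_iso_problem (\<lambda>_. True))"
    then obtain G H where "std_graph G" "std_graph H" "x = graph_code G @ graph_code H"
      "\<not> digraph_iso (with_proj G) (with_proj H)"
      unfolding graph_iso_problem_def by auto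
    then show "reduction Q F t x \<in> no_instances (graph_iso_problem (encoded_by J L LN))"
      unfolding graph_iso_problem_def promise_problem.simps mem_Collect_eq
      by (intro exI[of _ "enc G"] exI[of _ "enc H"])
         (simp add: reduction_graph_code std_graph_enc encoded_by_enc enc_iso_iff)
  qed
qed

end

theorem theorem3:
  fixes J :: "'j set"
    and L :: "'j \<Rightarrow> 'j \<Rightarrow> label"
    and LN :: "'j \<Rightarrow> 'j \<Rightarrow> enat"
  assumes "simple_path_encoding J L LN"
  shows "isomorphism_complete (encoded_by J L LN)"
proof -
  from assms obtain p where "path_encoding J L LN p"
    unfolding simple_path_encoding_def path_encoding_def by blast
  then interpret path_encoding J L LN p .
  \<comment> \<open>An instance of the class is an instance of the general problem with the same
    answer.\<close>
  have "poly_reducible (graph_iso_problem (encoded_by J L LN)) (graph_iso_problem (\<lambda>_. True))"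
    unfolding poly_reducible_def
    by (intro exI[of _ "\<lambda>x. x"] conjI poly_time_computable_id) (auto simp: graph_iso_problem_def)
  then show ?thesis
    unfolding isomorphism_complete_def poly_equivalent_def using reducible by blast
qed

end
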